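(* Let $(\lambda,\mu)\models n$ be a component-type with $2\leq \ell(\lambda)< n-\ell(\mu)$. Then $$W^{\lambda,\mu}_{n-\ell(\mu)-1}\;\geq\;\tfrac12\,W^{\lambda,\mu}_{n-\ell(\mu)},$$ and the constant $1/2$ is best possible (there exist such $(\lambda,\mu)$ for which equality holds).
   Context: Let $A,B$ be finite sets with $|A|=|B|=n$. For a bijection $f:A\to B$ (or $B\to A$), let $G_f$ be the directed graph on $A\cup B$ with an edge $x\to y$ whenever $f(x)=y$. Each connected component of $G_f$ is either a directed cycle or a directed path; $|f|$ denotes the number of components of $G_f$. The size of a cycle is its number of elements; the size of a path is its number of elements minus one. The component-type of $f$ is the pair $(\lambda,\mu)$ where $\lambda$ is the non-increasing sequence of path sizes and $\mu$ the non-increasing sequence of cycle sizes; then $\sum_i\lambda_i+\sum_j\mu_j=n$, written $(\lambda,\mu)\models n$, and $\ell(\lambda)$, $\ell(\mu)$ denote the numbers of parts (the number of paths and of cycles, respectively). For a bijection $D:B\to A$ of component-type $(\lambda,\mu)$, define $W^{\lambda,\mu}_k$ as the number of cyclic permutations $s$ of $A$ (i.e. $n$-cycles on $A$) such that the bijection $f=D^{-1}\circ s:A\to B$ satisfies $|f|=k$ (equivalently, the number of factorizations $D=s\circ f^{-1}$ with $s$ an $n$-cycle on $A$ and $f:A\to B$ a bijection with $k$ components); this number depends only on $(\lambda,\mu)$ and $k$, not on the particular choice of $A$, $B$, $D$. *)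

theory Defs
  imports Complex_Main "HOL-Library.Multiset" "HOL-Combinatorics.Combinatorics"
begin

text \<open>
  A bijection \<open>f\<close> from \<open>X\<close> to \<open>Y\<close> is a function on an ambient type of which only the values
  on \<open>X\<close> matter; the sets \<open>X\<close> and \<open>Y\<close> may overlap.  Its graph has vertex set \<open>X \<union> Y\<close>.
\<close>

definition graph_edges :: "'a set \<Rightarrow> ('a \<Rightarrow> 'a) \<Rightarrow> ('a \<times> 'a) set" where
  "graph_edges X f = {(x, f x) | x. x \<in> X}"

definition graph_components :: "'a set \<Rightarrow> 'a set \<Rightarrow> ('a \<Rightarrow> 'a) \<Rightarrow> 'a set set" where
  "graph_components X Y f = (X \<union> Y) // (graph_edges X f \<union> (graph_edges X f)\<inverse>)\<^sup>*"

definition num_components :: "'a set \<Rightarrow> 'a set \<Rightarrow> ('a \<Rightarrow> 'a) \<Rightarrow> nat" where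
  "num_components X Y f = card (graph_components X Y f)"

definition is_dipath :: "('a \<times> 'a) set \<Rightarrow> 'a set \<Rightarrow> bool" where
  "is_dipath E C \<longleftrightarrow> (\<exists>xs. xs \<noteq> [] \<and> distinct xs \<and> set xs = C \<and>
     E \<inter> C \<times> C = {(xs ! i, xs ! Suc i) | i. Suc i < length xs})"

text \<open>A loop on a single vertex is a directed cycle of size 1.\<close>

definition is_dicycle :: "('a \<times> 'a) set \<Rightarrow> 'a set \<Rightarrow> bool" where
  "is_dicycle E C \<longleftrightarrow> (\<exists>xs. xs \<noteq> [] \<and> distinct xs \<and> set xs = C \<and>
     E \<inter> C \<times> C = {(xs ! i, xs ! (Suc i mod length xs)) | i. i < length xs})"

definition path_components :: "'a set \<Rightarrow> 'a set \<Rightarrow> ('a \<Rightarrow> 'a) \<Rightarrow> 'a set set" where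
  "path_components X Y f = {C \<in> graph_components X Y f. is_dipath (graph_edges X f) C}"

definition cycle_components :: "'a set \<Rightarrow> 'a set \<Rightarrow> ('a \<Rightarrow> 'a) \<Rightarrow> 'a set set" where
  "cycle_components X Y f = {C \<in> graph_components X Y f. is_dicycle (graph_edges X f) C}"

definition component_type :: "'a set \<Rightarrow> 'a set \<Rightarrow> ('a \<Rightarrow> 'a) \<Rightarrow> nat list \<times> nat list" where
  "component_type X Y f =
     (rev (sorted_list_of_multiset
        (image_mset (\<lambda>C. card C - 1) (mset_set (path_components X Y f)))),
      rev (sorted_list_of_multiset
        (image_mset card (mset_set (cycle_components X Y f)))))"

definition bij_of_type ::
  "nat \<Rightarrow> 'a set \<Rightarrow> 'a set \<Rightarrow> ('a \<Rightarrow> 'a) \<Rightarrow> nat list \<Rightarrow> nat list \<Rightarrow> bool" where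
  "bij_of_type n A B D lam mu \<longleftrightarrow>
     finite A \<and> finite B \<and> card A = n \<and> card B = n \<and> bij_betw D B A \<and>
     component_type B A D = (lam, mu)"

text \<open>
  For \<open>D\<close> of component-type \<open>(\<lambda>, \<mu>)\<close>, the number \<open>W A B D k\<close> is the one denoted
  \<open>W\<close> with superscripts \<open>\<lambda>, \<mu>\<close> and subscript \<open>k\<close>: it depends on \<open>A\<close>, \<open>B\<close>, \<open>D\<close> only
  through \<open>(\<lambda>, \<mu>)\<close>.
\<close>

definition W :: "'a set \<Rightarrow> 'a set \<Rightarrow> ('a \<Rightarrow> 'a) \<Rightarrow> nat \<Rightarrow> nat" where
  "W A B D k = card {s. s permutes A \<and> cyclic_on s A \<and>
                        num_components A B (inv_into B D \<circ> s) = k}"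

end

theory Submission
  imports Defs
begin

text \<open>
  Joining the end of each path of \<open>D\<close> to its start turns \<open>D\<close> into a permutation of \<open>A\<close> and
  \<open>f = D\<^sup>-\<^sup>1 \<circ> s\<close> into a permutation of \<open>A\<close>; the components of the original \<open>f\<close> are \<open>\<ell>(\<lambda>)\<close> paths
  and the cycles of this permutation that avoid \<open>S = A - B\<close>.  Since \<open>D \<circ> f\<close> is an \<open>n\<close>-cycle, the numbers of cycles of \<open>D\<close> and \<open>f\<close> add
  up to at most \<open>n + 1\<close> (multiply by transpositions), and both counts in question concern the
  planar case of equality, where the cycles of \<open>D\<close> and \<open>f\<close> are the black and white vertices of a
  tree with edge set \<open>A\<close>: the top count asks that \<open>S\<close> lie in one cycle of \<open>f\<close>, the next one that
  \<open>S\<close> meet exactly two.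

  Given a top configuration, choose \<open>b\<close> in the cycle containing \<open>S\<close> with \<open>D b \<noteq> b\<close>, put
  \<open>a = D\<^sup>-\<^sup>1 b\<close>, and let \<open>u\<close> be the first element of \<open>S\<close> after \<open>b\<close> in the cyclic order of \<open>f\<close>.
  Replacing \<open>f\<close> by \<open>(a u) \<circ> f \<circ> (b u)\<close> moves \<open>u\<close>, and no other element of \<open>S\<close>, to the cycle of
  \<open>a\<close>, and stays planar.  In the tree, \<open>a\<close> is determined by the ordered pair of white vertices at \<open>a\<close>
  and \<open>b\<close>, and then \<open>u\<close> is the only element of \<open>S\<close> in the cycle of \<open>a\<close>; so this map is at most
  two-to-one.

  Equality holds for \<open>\<lambda> = (1, 1)\<close>, \<open>\<mu> = (2)\<close>: at least four of the six \<open>4\<close>-cycles are top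
  configurations, which together with the inequality leaves exactly four and two.
\<close>

section \<open>Cycle counts and transpositions\<close>

definition cyc :: "'a set \<Rightarrow> ('a \<Rightarrow> 'a) \<Rightarrow> nat" where
  "cyc A g = card (orbit g ` A)"

lemma orbit_eq_of_mem:
  assumes "permutation g" "y \<in> orbit g x"
  shows "orbit g y = orbit g x"
  using cyclic_on_orbit'[OF assms(1), of x] assms(2) by (rule orbit_cyclic_eq3)

lemma orbit_mem_sym:
  assumes "permutation g" "y \<in> orbit g x"
  shows "x \<in> orbit g y"
  using assms orbit_eq_of_mem permutation_self_in_orbit by metis

text \<open>Left multiplication by a transposition equals right multiplication by the transposition
  of the two preimages. This lemma carries the orbit condition along, so that results for
  \<open>g \<circ> transpose x y\<close> pass to \<open>transpose x y \<circ> g\<close>.\<close>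

lemma inv_mem_orbit_iff:
  assumes "permutation g"
  shows "inv g y \<in> orbit g (inv g x) \<longleftrightarrow> y \<in> orbit g x"
proof -
  have g: "g (inv g z) = z" for z
    using assms by (simp add: permutation_inverse_works bij_is_surj permutation_bijective surj_f_inv_f)
  have o: "orbit g (inv g z) = orbit g z" for z
    using permutation_orbit_step[OF assms, of "inv g z"] g by simp
  show ?thesis
    using o orbit_eq_of_mem[OF assms] permutation_self_in_orbit[OF assms] by metis
qed

lemma permutation_comp_transpose:
  assumes "permutation g"
  shows "permutation (g \<circ> transpose x y)"
  using assms by (simp add: permutation_compose permutation_swap_id)

lemma permutation_transpose_comp:
  assumes "permutation g"
  shows "permutation (transpose x y \<circ> g)"
  using assms by (simp add: permutation_compose permutation_swap_id)

text \<open>The new map sends \<open>x\<close> to \<open>g y\<close> and then follows the old cycle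
  of \<open>y\<close>, which does not contain \<open>x\<close>, until it reaches
  \<open>y\<close>.\<close>

lemma orbit_subset_orbit_comp_transpose:
  assumes g: "permutation g" and xy: "y \<notin> orbit g x"
  shows "orbit g y \<subseteq> orbit (g \<circ> transpose x y) x"
proof
  let ?h = "g \<circ> transpose x y"
  fix z assume "z \<in> orbit g y"
  then show "z \<in> orbit ?h x"
  proof induction
    case base
    show ?case using orbit.base[of ?h x] by (simp add: o_def)
  next
    case (step z)
    have "z \<noteq> x" using step.hyps xy orbit_mem_sym[OF g] by blast
    show ?case
    proof (cases "z = y")
      case True
      then show ?thesis using orbit.base[of ?h x] by (simp add: o_def)
    next
      case False
      then show ?thesis using orbit.step[OF step.IH] \<open>z \<noteq> x\<close> by (simp add: o_def)
    qed
  qed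
qed

lemma orbit_comp_transpose_merge:
  assumes g: "permutation g" and xy: "y \<notin> orbit g x"
  shows "orbit (g \<circ> transpose x y) x = orbit g x \<union> orbit g y"
proof
  let ?h = "g \<circ> transpose x y"
  have h: "permutation ?h" using g by (rule permutation_comp_transpose)
  have 1: "orbit g y \<subseteq> orbit ?h x" by (rule orbit_subset_orbit_comp_transpose[OF assms])
  have "x \<notin> orbit g y" using xy orbit_mem_sym[OF g] by blast
  then have 2: "orbit g x \<subseteq> orbit ?h y"
    using orbit_subset_orbit_comp_transpose[OF g, of x y] by (simp add: transpose_commute)
  have "y \<in> orbit ?h x" using 1 permutation_self_in_orbit[OF g] by blast
  then have "orbit ?h y = orbit ?h x" by (rule orbit_eq_of_mem[OF h])
  then show "orbit g x \<union> orbit g y \<subseteq> orbit ?h x" using 1 2 by blast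
  show "orbit ?h x \<subseteq> orbit g x \<union> orbit g y"
  proof
    fix z assume "z \<in> orbit ?h x"
    then show "z \<in> orbit g x \<union> orbit g y"
    proof induction
      case base
      then show ?case by (simp add: orbit.base)
    next
      case (step z)
      then show ?case
        by (cases "z = x"; cases "z = y") (auto intro: orbit.intros)
    qed
  qed
qed

text \<open>From \<open>x\<close> the new map goes to \<open>g y\<close> and runs along the old
  cycle up to \<open>x\<close>, where it returns to \<open>g y\<close>. The arc \<open>P\<close> of
  these points is closed under the new map and omits \<open>y\<close>.\<close>

lemma orbit_comp_transpose_split:
  assumes g: "permutation g" and xy: "y \<in> orbit g x" "x \<noteq> y"
  shows "y \<notin> orbit (g \<circ> transpose x y) x"
proof -
  let ?h = "g \<circ> transpose x y"
  define m where "m = funpow_dist1 g y x"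
  define P where "P = {(g ^^ j) y |j. 0 < j \<and> j \<le> m}"
  have x: "x \<in> orbit g y" using xy(1) orbit_mem_sym[OF g] by blast
  have m: "(g ^^ m) y = x" "0 < m"
    unfolding m_def using funpow_dist1_prop[OF x] by auto
  have ny: "(g ^^ j) y \<noteq> y" if "0 < j" "j < m" for j
    using funpow_neq_less_funpow_dist1[OF x, of j 0] that unfolding m_def by simp
  have nx: "(g ^^ j) y \<noteq> x" if "0 < j" "j < m" for j
    using funpow_dist1_least[of j g y x] that unfolding m_def by simp
  have "g y \<in> P" unfolding P_def using m(2) by (auto intro!: exI[of _ "Suc 0"])
  have "orbit ?h x \<subseteq> P"
  proof
    fix z assume "z \<in> orbit ?h x"
    then show "z \<in> P"
    proof induction
      case base
      then show ?case using \<open>g y \<in> P\<close> by simp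
    next
      case (step z)
      then obtain j where j: "z = (g ^^ j) y" "0 < j" "j \<le> m" unfolding P_def by blast
      show ?case
      proof (cases "j = m")
        case True
        then show ?thesis using j m \<open>g y \<in> P\<close> by simp
      next
        case False
        then have "?h z = (g ^^ Suc j) y" using j nx ny by simp
        then show ?thesis unfolding P_def using j False by (auto intro!: exI[of _ "Suc j"])
      qed
    qed
  qed
  moreover have "y \<notin> P" 
  proof
    assume "y \<in> P"
    then obtain j where j: "(g ^^ j) y = y" "0 < j" "j \<le> m" unfolding P_def by (smt (verit) mem_Collect_eq)
    then show False using ny[of j] m(1) xy(2) by (cases "j = m") auto
  qed
  ultimately show ?thesis by blast
qed

lemma orbit_transpose_comp_split:
  assumes g: "permutation g" and xy: "y \<in> orbit g x" "x \<noteq> y"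
  shows "y \<notin> orbit (transpose x y \<circ> g) x"
proof -
  let ?h = "transpose x y \<circ> g"
  have b: "bij g" using g by (rule permutation_bijective)
  have gi: "g (inv g z) = z" for z using b by (simp add: bij_is_surj surj_f_inv_f)
  have h: "permutation ?h" using g by (rule permutation_transpose_comp)
  have eq: "?h = g \<circ> transpose (inv g x) (inv g y)" by (rule transpose_comp_eq[OF b])
  have "inv g y \<notin> orbit ?h (inv g x)"
    unfolding eq
    using orbit_comp_transpose_split[OF g, of "inv g y" "inv g x"] inv_mem_orbit_iff[OF g] xy gi
    by metis
  moreover have "?h (inv g x) = y" "?h (inv g y) = x" by (simp_all add: gi)
  ultimately show ?thesis
    using permutation_orbit_step[OF h] orbit_mem_sym[OF h] permutation_self_in_orbit[OF h] 
    by metis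
qed

lemma cyc_comp_transpose_merge:
  assumes A: "finite A" and gA: "g permutes A" and mem: "x \<in> A" "y \<in> A"
    and xy: "y \<notin> orbit g x"
  shows "Suc (cyc A (g \<circ> transpose x y)) = cyc A g"
proof -
  let ?h = "g \<circ> transpose x y"
  have g: "permutation g" using A gA by (auto simp: permutation_permutes)
  have h: "permutation ?h" using g by (rule permutation_comp_transpose)
  let ?U = "orbit g x \<union> orbit g y"
  have U: "orbit ?h x = ?U" by (rule orbit_comp_transpose_merge[OF g xy])
  have sg: "z \<in> orbit g z" for z by (rule permutation_self_in_orbit[OF g])
  have inU: "orbit ?h z = ?U" if "z \<in> ?U" for z
    using orbit_eq_of_mem[OF h] U that by blast
  have outU: "orbit ?h z = orbit g z" if "z \<notin> ?U" for z
  proof (rule orbit_cong[OF sg])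
    fix w assume "w \<in> orbit g z"
    then have "w \<noteq> x" "w \<noteq> y" using that orbit_mem_sym[OF g] by auto
    then show "?h w = g w" by simp
  qed
  have out_iff: "z \<notin> ?U \<longleftrightarrow> orbit g z \<noteq> orbit g x \<and> orbit g z \<noteq> orbit g y" for z
    using sg orbit_eq_of_mem[OF g] by blast
  \<comment> \<open>The orbits that contain neither \<open>x\<close> nor \<open>y\<close>; they are
    common to \<open>g\<close> and \<open>?h\<close>.\<close>
  define R where "R = orbit g ` A - {orbit g x, orbit g y}"
  have R: "R = orbit g ` {z \<in> A. z \<notin> ?U}" unfolding R_def using out_iff by blast
  have "orbit ?h ` A = orbit ?h ` {z \<in> A. z \<notin> ?U} \<union> orbit ?h ` {z \<in> A. z \<in> ?U}" by blast
  also have "orbit ?h ` {z \<in> A. z \<notin> ?U} = R"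
    unfolding R by (rule image_cong) (use outU in auto)
  also have "orbit ?h ` {z \<in> A. z \<in> ?U} = {?U}"
    using inU mem(1) sg by (auto simp: image_iff)
  finally have h_img: "orbit ?h ` A = insert ?U R" by (simp only: Un_insert_right Un_empty_right)
  have "?U \<notin> R" unfolding R using sg by blast
  then have ch: "cyc A ?h = Suc (card R)" unfolding cyc_def h_img using A by (simp add: R)
  have "orbit g ` A = insert (orbit g x) (insert (orbit g y) R)"
    unfolding R_def using mem by blast
  moreover have "orbit g x \<noteq> orbit g y" using xy sg by blast
  moreover have "orbit g x \<notin> R" "orbit g y \<notin> R" "finite R" unfolding R_def using A by auto
  ultimately have "cyc A g = Suc (Suc (card R))" unfolding cyc_def by simp
  then show ?thesis using ch by simp
qed

text \<open>Multiplying by the same transposition again gives back \<open>g\<close>, so this is the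
  merging lemma applied to \<open>?h\<close>.\<close>

lemma cyc_comp_transpose_split:
  assumes A: "finite A" and gA: "g permutes A" and mem: "x \<in> A"
    and xy: "y \<in> orbit g x" "x \<noteq> y"
  shows "cyc A (g \<circ> transpose x y) = Suc (cyc A g)"
proof -
  let ?h = "g \<circ> transpose x y"
  have g: "permutation g" using A gA by (auto simp: permutation_permutes)
  have y: "y \<in> A" using permutes_orbit_subset[OF gA mem] xy by blast
  have "?h permutes A" using permutes_compose[OF permutes_swap_id[OF mem y] gA] .
  from cyc_comp_transpose_merge[OF A this mem y orbit_comp_transpose_split[OF g xy]]
  show ?thesis by (simp add: comp_assoc)
qed

lemma cyc_transpose_comp_merge:
  assumes A: "finite A" and gA: "g permutes A" and mem: "x \<in> A" "y \<in> A"
    and xy: "y \<notin> orbit g x"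
  shows "Suc (cyc A (transpose x y \<circ> g)) = cyc A g"
proof -
  have g: "permutation g" using A gA by (auto simp: permutation_permutes)
  have i: "inv g x \<in> A" "inv g y \<in> A"
    using mem permutes_in_image[OF permutes_inv[OF gA]] by auto
  show ?thesis
    using cyc_comp_transpose_merge[OF A gA i] xy inv_mem_orbit_iff[OF g]
      transpose_comp_eq[OF permutes_bij[OF gA]] by metis
qed

lemma cyc_transpose_comp_split:
  assumes A: "finite A" and gA: "g permutes A" and mem: "x \<in> A"
    and xy: "y \<in> orbit g x" "x \<noteq> y"
  shows "cyc A (transpose x y \<circ> g) = Suc (cyc A g)"
proof -
  have g: "permutation g" using A gA by (auto simp: permutation_permutes)
  have i: "inv g x \<in> A" "inv g x \<noteq> inv g y"
    using mem permutes_in_image[OF permutes_inv[OF gA]] xy(2) permutes_inverses[OF gA] by metis+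
  show ?thesis
    using cyc_comp_transpose_split[OF A gA i(1) _ i(2)] xy inv_mem_orbit_iff[OF g]
      transpose_comp_eq[OF permutes_bij[OF gA]] by metis
qed

lemma cyc_transpose_comp_ge:
  assumes A: "finite A" and gA: "g permutes A" and mem: "x \<in> A" "y \<in> A"
  shows "cyc A g \<le> Suc (cyc A (transpose x y \<circ> g))"
  using cyc_transpose_comp_merge[OF assms] cyc_transpose_comp_split[OF A gA mem(1), of y]
  by (cases "x = y"; cases "y \<in> orbit g x") auto

lemma cyclic_on_iff_cyc:
  assumes A: "finite A" and gA: "g permutes A"
  shows "cyclic_on g A \<longleftrightarrow> cyc A g = 1"
proof
  assume c: "cyclic_on g A"
  then have "A \<noteq> {}" by (auto simp: cyclic_on_def)
  moreover have "orbit g x = A" if "x \<in> A" for x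
    using orbit_cyclic_eq3[OF c that] .
  ultimately have "orbit g ` A = {A}" by (auto simp: image_iff)
  then show "cyc A g = 1" by (simp add: cyc_def)
next
  assume "cyc A g = 1"
  then obtain C where C: "orbit g ` A = {C}" unfolding cyc_def by (metis card_1_singletonE)
  then obtain x where x: "x \<in> A" by blast
  have g: "permutation g" using A gA by (auto simp: permutation_permutes)
  have "A \<subseteq> C"
    using C permutation_self_in_orbit[OF g] by blast
  moreover have "C \<subseteq> A" using C x permutes_orbit_subset[OF gA x] by blast
  ultimately have "A = orbit g x" using C x by blast
  then show "cyclic_on g A" using x by (auto simp: cyclic_on_def)
qed

lemma cyc_le_card:
  assumes "finite A" shows "cyc A g \<le> card A"
  unfolding cyc_def using assms by (rule card_image_le)

lemma cyc_id: "cyc A id = card A"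
proof -
  have "orbit id x = {x}" for x :: 'a by (simp add: orbit_eq_singleton_iff)
  then show ?thesis unfolding cyc_def by (simp add: card_image)
qed

text \<open>While \<open>D\<close> is not the identity, a transposition that splits a cycle of
  \<open>D\<close> can be moved from \<open>D\<close> to \<open>f\<close>. The product stays the
  same, the count for \<open>D\<close> rises by one and the count for \<open>f\<close> drops by at
  most one. For \<open>D = id\<close> the factor \<open>f\<close> is itself the full cycle.\<close>

lemma cyc_sum_le:
  assumes A: "finite A" and "D permutes A" "f permutes A" "cyclic_on (D \<circ> f) A"
  shows "cyc A D + cyc A f \<le> Suc (card A)"
  using assms(2-4)
proof (induction "card A - cyc A D" arbitrary: D f rule: less_induct)
  case less
  have cycl: "cyc A (D \<circ> f) = 1"
    using cyclic_on_iff_cyc[OF A permutes_compose[OF less.prems(2,1)]] less.prems(3) by simp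
  show ?case
  proof (cases "D = id")
    case True
    then show ?thesis using cycl by (simp add: cyc_id)
  next
    case False
    then obtain x where x: "D x \<noteq> x" by (auto simp: fun_eq_iff)
    then have xA: "x \<in> A" "D x \<in> A"
      using permutes_not_in[OF less.prems(1)] permutes_in_image[OF less.prems(1)] by blast+
    let ?t = "transpose x (D x)"
    have c: "cyc A (D \<circ> ?t) = Suc (cyc A D)"
      using cyc_comp_transpose_split[OF A less.prems(1) xA(1) orbit.base] x by simp
    have t: "?t permutes A" using xA by (rule permutes_swap_id)
    have p: "D \<circ> ?t permutes A" "?t \<circ> f permutes A"
      using permutes_compose[OF t less.prems(1)] permutes_compose[OF less.prems(2) t] by auto
    have e: "(D \<circ> ?t) \<circ> (?t \<circ> f) = D \<circ> f" by (simp add: fun_eq_iff)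
    have "card A - cyc A (D \<circ> ?t) < card A - cyc A D"
      using c cyc_le_card[OF A, of "D \<circ> ?t"] by linarith
    from less.hyps[OF this p] less.prems(3)
    have "cyc A (D \<circ> ?t) + cyc A (?t \<circ> f) \<le> Suc (card A)" unfolding e by blast
    then show ?thesis using c cyc_transpose_comp_ge[OF A less.prems(2) xA] by linarith
  qed
qed

section \<open>Planar pairs of permutations\<close>

definition planar_pair :: "'a set \<Rightarrow> ('a \<Rightarrow> 'a) \<Rightarrow> ('a \<Rightarrow> 'a) \<Rightarrow> bool" where
  "planar_pair A D f \<longleftrightarrow> finite A \<and> D permutes A \<and> f permutes A \<and> cyclic_on (D \<circ> f) A \<and>
     cyc A D + cyc A f = Suc (card A)"

text \<open>The tree has no double edge. If \<open>x\<close> and \<open>y\<close> shared both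
  cycles, inserting their transposition between \<open>D\<close> and \<open>f\<close> would split
  both cycles and violate \<open>cyc_sum_le\<close>.\<close>

lemma planar_pair_orbits_meet:
  assumes "planar_pair A D f" "x \<in> A" "y \<in> orbit D x" "y \<in> orbit f x"
  shows "y = x"
proof (rule ccontr)
  assume "y \<noteq> x"
  have A: "finite A" and D: "D permutes A" and f: "f permutes A" and s: "cyclic_on (D \<circ> f) A"
    and sum: "cyc A D + cyc A f = Suc (card A)"
    using assms(1) by (auto simp: planar_pair_def)
  have y: "y \<in> A" using permutes_orbit_subset[OF D assms(2)] assms(3) by blast
  let ?t = "transpose x y"
  have t: "?t permutes A" using assms(2) y by (rule permutes_swap_id)
  have "(D \<circ> ?t) \<circ> (?t \<circ> f) = D \<circ> f" by (simp add: fun_eq_iff)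
  then have "cyc A (D \<circ> ?t) + cyc A (?t \<circ> f) \<le> Suc (card A)"
    using cyc_sum_le[OF A permutes_compose[OF t D] permutes_compose[OF f t]] s by simp
  moreover have "cyc A (D \<circ> ?t) = Suc (cyc A D)" "cyc A (?t \<circ> f) = Suc (cyc A f)"
    using cyc_comp_transpose_split[OF A D assms(2,3)] cyc_transpose_comp_split[OF A f assms(2,4)]
      \<open>y \<noteq> x\<close> by auto
  ultimately show False using sum by simp
qed

text \<open>Two black vertices joined to the same two white vertices would form a closed walk of
  length four in the tree. To see the contradiction, insert the transposition of \<open>a\<close>
  and \<open>a'\<close>: it merges their cycles of \<open>D\<close> and splits their common cycle of
  \<open>f\<close>, so the pair stays planar. The white cycle of \<open>D a\<close> is untouched,
  and \<open>D a\<close>, \<open>D a'\<close> now share both cycles.\<close>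

lemma planar_pair_step_unique:
  assumes pl: "planar_pair A D f" and a: "a \<in> A" "a' \<in> orbit f a"
    and Da: "D a' \<in> orbit f (D a)" "D a \<notin> orbit f a"
  shows "a' = a"
proof (rule ccontr)
  assume ne: "a' \<noteq> a"
  have A: "finite A" and D: "D permutes A" and f: "f permutes A" and s: "cyclic_on (D \<circ> f) A"
    and sum: "cyc A D + cyc A f = Suc (card A)"
    using pl by (auto simp: planar_pair_def)
  have pD: "permutation D" and pf: "permutation f"
    using A D f by (auto simp: permutation_permutes)
  have a': "a' \<in> A" using permutes_orbit_subset[OF f a(1)] a(2) by blast
  let ?t = "transpose a a'"
  have t: "?t permutes A" using a(1) a' by (rule permutes_swap_id)
  let ?D = "D \<circ> ?t" and ?f = "?t \<circ> f"
  have Dp: "?D permutes A" and fp: "?f permutes A"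
    using permutes_compose[OF t D] permutes_compose[OF f t] by auto
  have pD': "permutation ?D" using pD by (rule permutation_comp_transpose)
  have eq: "?D \<circ> ?f = D \<circ> f" by (simp add: fun_eq_iff)
  have "a' \<notin> orbit D a" using planar_pair_orbits_meet[OF pl a(1)] a(2) ne by blast
  then have cD: "Suc (cyc A ?D) = cyc A D" and oD: "orbit ?D a = orbit D a \<union> orbit D a'"
    using cyc_comp_transpose_merge[OF A D a(1) a'] orbit_comp_transpose_merge[OF pD] by auto
  have cf: "cyc A ?f = Suc (cyc A f)" using cyc_transpose_comp_split[OF A f a] ne by blast
  have pl': "planar_pair A ?D ?f"
    unfolding planar_pair_def using A Dp fp eq s sum cD cf by simp
  have self: "D a \<in> orbit f (D a)" by (rule permutation_self_in_orbit[OF pf])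
  have "orbit ?f (D a) = orbit f (D a)"
  proof (rule orbit_cong[OF self])
    fix z assume "z \<in> orbit f (D a)"
    then have "f z \<in> orbit f (D a)" by (rule orbit.step)
    then have "f z \<noteq> a" "f z \<noteq> a'"
      using Da(2) a(2) orbit_eq_of_mem[OF pf] self orbit_mem_sym[OF pf] by metis+
    then show "?f z = f z" by simp
  qed
  then have "D a' \<in> orbit ?f (D a)" using Da(1) by simp
  moreover have "D a' \<in> orbit ?D (D a)"
  proof -
    have "D a \<in> orbit ?D a" "D a' \<in> orbit ?D a" unfolding oD by (auto intro: orbit.base)
    then show ?thesis using orbit_eq_of_mem[OF pD'] by metis
  qed
  moreover have "D a \<in> A" using a(1) permutes_in_image[OF D] by blast
  ultimately have "D a' = D a" using planar_pair_orbits_meet[OF pl'] by blast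
  then show False using ne permutes_inj[OF D] by (auto dest: injD)
qed

section \<open>Moving one element to a neighbouring cycle\<close>

lemma cyclic_on_transpose_rotate:
  assumes "cyclic_on (transpose x y \<circ> g) A" "x \<in> A" "y \<in> A"
  shows "cyclic_on (g \<circ> transpose x y) A"
  using cyclic_on_image[OF assms(1), of "g \<circ> transpose x y" "transpose x y"] assms(2,3) by simp

text \<open>With \<open>b = D a\<close>, the new product is a conjugate of
  \<open>D \<circ> f\<close> multiplied on the left by two transpositions. Either these cancel, or
  the first splits the cycle and the second joins the two pieces again; planarity excludes that the
  second splits once more.\<close>

lemma planar_pair_transfer:
  assumes pl: "planar_pair A D f" and a: "a \<in> A" "D a \<noteq> a"
    and u: "u \<in> orbit f (D a)" "u \<noteq> D a"
  shows "planar_pair A D (transpose a u \<circ> f \<circ> transpose (D a) u)"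
proof -
  define b where "b = D a"
  have A: "finite A" and D: "D permutes A" and f: "f permutes A" and s: "cyclic_on (D \<circ> f) A"
    and sum: "cyc A D + cyc A f = Suc (card A)"
    using pl by (auto simp: planar_pair_def)
  have pf: "permutation f" using A f by (auto simp: permutation_permutes)
  have bA: "b \<in> A" using a permutes_in_image[OF D] by (simp add: b_def)
  have uA: "u \<in> A" using permutes_orbit_subset[OF f bA] u(1) by (auto simp: b_def)
  have cA: "D u \<in> A" using uA permutes_in_image[OF D] by simp
  have ub: "u \<in> orbit f b" "u \<noteq> b" using u by (auto simp: b_def)
  have "b \<in> orbit D a" unfolding b_def by (rule orbit.base)
  then have "b \<notin> orbit f a" using planar_pair_orbits_meet[OF pl a(1)] a(2) by (auto simp: b_def)
  then have "u \<noteq> a" using ub orbit_mem_sym[OF pf] by blast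
  then have cb: "D u \<noteq> b" unfolding b_def using permutes_inj[OF D] by (auto dest: injD)
  let ?bu = "transpose b u" and ?au = "transpose a u" and ?bc = "transpose b (D u)"
  have bu: "?bu permutes A" and au: "?au permutes A" and bc: "?bc permutes A"
    using a(1) bA uA cA by (auto intro: permutes_swap_id)
  let ?f = "?au \<circ> (f \<circ> ?bu)"
  have fbu: "f \<circ> ?bu permutes A" using permutes_compose[OF bu f] .
  have fp: "?f permutes A" using permutes_compose[OF fbu au] .
  have cfbu: "cyc A (f \<circ> ?bu) = Suc (cyc A f)"
    using cyc_comp_transpose_split[OF A f bA ub(1)] ub(2) by blast
  define s where "s = D \<circ> f"
  have sA: "s permutes A" unfolding s_def using permutes_compose[OF f D] .
  have scyc: "cyclic_on s A" using s by (simp add: s_def)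
  then have cs: "cyc A s = 1" using cyclic_on_iff_cyc[OF A sA] by simp
  have ps: "permutation s" using A sA by (auto simp: permutation_permutes)
  \<comment> \<open>\<open>D\<close> sends the pair \<open>a\<close>, \<open>u\<close> to the pair
    \<open>b\<close>, \<open>D u\<close>, so the transposition can be pulled to the left of
    \<open>D\<close>.\<close>
  have Dtau: "D \<circ> ?au = ?bc \<circ> D"
    using permutes_inj[OF D] by (auto simp: fun_eq_iff transpose_def b_def dest: injD)
  have "D \<circ> ?f = (D \<circ> ?au) \<circ> f \<circ> ?bu" by (simp add: comp_assoc)
  then have Df: "D \<circ> ?f = (?bc \<circ> s) \<circ> ?bu" unfolding Dtau s_def by (simp add: comp_assoc)
  have "cyclic_on (D \<circ> ?f) A"
  proof (cases "D u = u")
    case True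
    then have "transpose b u \<circ> (?bc \<circ> s) = s" by (simp add: fun_eq_iff)
    then have "cyclic_on (transpose b u \<circ> (?bc \<circ> s)) A" using scyc by simp
    then show ?thesis unfolding Df using bA uA by (rule cyclic_on_transpose_rotate)
  next
    case False
    let ?s = "?bc \<circ> s"
    have s2: "?s permutes A" using permutes_compose[OF sA bc] .
    have p2: "permutation ?s" using A s2 by (auto simp: permutation_permutes)
    have "D u \<in> orbit s b" using scyc bA cA by (simp add: orbit_cyclic_eq3)
    then have c2: "cyc A ?s = 2" and n2: "D u \<notin> orbit ?s b"
      using cyc_transpose_comp_split[OF A sA bA] orbit_transpose_comp_split[OF ps] cb cs by auto
    \<comment> \<open>Otherwise \<open>u\<close> and \<open>D u\<close> lie in different pieces, and
      their transposition joins these to a full cycle. After rewriting and conjugating, this is a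
      full cycle with the factors \<open>transpose u (D u) \<circ> D\<close> and
      \<open>f \<circ> ?bu\<close>, each of which has one cycle more than \<open>D\<close> and
      \<open>f\<close>. That exceeds the bound of \<open>cyc_sum_le\<close>.\<close>
    have "u \<notin> orbit ?s b"
    proof
      assume "u \<in> orbit ?s b"
      then have "D u \<notin> orbit ?s u" using n2 orbit_eq_of_mem[OF p2] by metis
      then have "cyc A (transpose u (D u) \<circ> ?s) = 1"
        using cyc_transpose_comp_merge[OF A s2 uA cA] c2 by simp
      moreover have "transpose u (D u) \<circ> ?s permutes A"
        using permutes_compose[OF s2 permutes_swap_id[OF uA cA]] .
      ultimately have "cyclic_on (transpose u (D u) \<circ> ?s) A"
        using cyclic_on_iff_cyc[OF A] by blast
      moreover have "transpose u (D u) \<circ> ?s = ?bu \<circ> (transpose u (D u) \<circ> s)"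
        using False cb ub(2) by (auto simp: fun_eq_iff transpose_def)
      ultimately have "cyclic_on (transpose u (D u) \<circ> s \<circ> ?bu) A"
        using bA uA by (metis cyclic_on_transpose_rotate)
      moreover have "transpose u (D u) \<circ> s \<circ> ?bu = (transpose u (D u) \<circ> D) \<circ> (f \<circ> ?bu)"
        by (simp add: s_def comp_assoc)
      ultimately have "cyc A (transpose u (D u) \<circ> D) + cyc A (f \<circ> ?bu) \<le> Suc (card A)"
        using cyc_sum_le[OF A permutes_compose[OF D permutes_swap_id[OF uA cA]] fbu] by simp
      moreover have "cyc A (transpose u (D u) \<circ> D) = Suc (cyc A D)"
        using cyc_transpose_comp_split[OF A D uA orbit.base] False by auto
      ultimately show False using cfbu sum by simp
    qed
    then have "cyc A (?bu \<circ> ?s) = 1" using cyc_transpose_comp_merge[OF A s2 bA uA] c2 by simp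
    then have "cyclic_on (?bu \<circ> ?s) A"
      using cyclic_on_iff_cyc[OF A permutes_compose[OF s2 bu]] by blast
    then show ?thesis unfolding Df using bA uA by (rule cyclic_on_transpose_rotate)
  qed
  \<comment> \<open>The right transposition gains a cycle and the left one loses at most one.
    Together with the upper bound of \<open>cyc_sum_le\<close> this gives equality.\<close>
  moreover have "cyc A f \<le> cyc A ?f"
    using cyc_transpose_comp_ge[OF A fbu a(1) uA] cfbu by simp
  ultimately have "planar_pair A D ?f"
    unfolding planar_pair_def using A D fp sum cyc_sum_le[OF A D fp] by simp
  then show ?thesis by (simp add: b_def comp_assoc)
qed

text \<open>Take for \<open>u\<close> the first element of \<open>S\<close> met after
  \<open>b\<close>. The new map inserts the arc from \<open>f b\<close> to \<open>u\<close> into the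
  cycle of \<open>a\<close> and closes the rest of the old cycle, from \<open>f u\<close> to
  \<open>b\<close>, on its own. The inserted arc meets \<open>S\<close> only in
  \<open>u\<close>.\<close>

lemma orbit_separate_first:
  assumes f: "permutation f" and ab: "b \<notin> orbit f a"
    and S: "S \<subseteq> orbit f b" "v \<in> S" "v \<noteq> b"
  shows "\<exists>u. u \<in> S \<and> u \<noteq> b \<and>
    S \<inter> orbit (transpose a u \<circ> f \<circ> transpose b u) a = {u} \<and>
    S - {u} \<subseteq> orbit (transpose a u \<circ> f \<circ> transpose b u) b \<and>
    b \<notin> orbit (transpose a u \<circ> f \<circ> transpose b u) a"
proof -
  \<comment> \<open>The index is positive, so the start \<open>b\<close> is passed over even if it
    belongs to \<open>S\<close>.\<close>
  define k where "k = (LEAST i. 0 < i \<and> (f ^^ i) b \<in> S)"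
  define u where "u = (f ^^ k) b"
  have "\<exists>i. 0 < i \<and> (f ^^ i) b \<in> S"
    using S by (auto simp: orbit_altdef)
  then have k: "0 < k" "u \<in> S" 
    using LeastI_ex[of "\<lambda>i. 0 < i \<and> (f ^^ i) b \<in> S"] unfolding u_def k_def by blast+
  have k_least: "k \<le> i" if "0 < i" "(f ^^ i) b \<in> S" for i
    unfolding k_def using that by (auto intro: Least_le)
  have vb: "v \<in> orbit f b" using S by blast
  \<comment> \<open>A first hit at \<open>b\<close> would mean a full turn of the cycle, on which
    \<open>v\<close> is met earlier.\<close>
  have ub: "u \<noteq> b"
  proof
    assume "u = b"
    then have "(f ^^ k) b = b" by (simp add: u_def)
    then obtain i where i: "v = (f ^^ i) b" "i < k"
      using orbit_altdef_bounded[of k f b] k(1) vb by auto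
    then have "0 < i" using S(3) by (cases i) auto
    then show False using k_least[of i] i S(2) by simp
  qed
  have uob: "u \<in> orbit f b" using k(2) S(1) by blast
  have selff: "x \<in> orbit f x" for x by (rule permutation_self_in_orbit[OF f])
  have disj: "x \<notin> orbit f b" if "x \<in> orbit f a" for x
    using that ab orbit_eq_of_mem[OF f] selff by metis
  have inj: "inj f" using permutation_bijective[OF f] by (simp add: bij_is_inj)
  have ua: "u \<noteq> a" using disj uob selff by blast
  have ba: "b \<noteq> a" using ab selff by blast
  let ?f = "transpose a u \<circ> f \<circ> transpose b u"
  have f': "permutation ?f" by (intro permutation_comp_transpose permutation_transpose_comp f)
  have selff': "x \<in> orbit ?f x" for x by (rule permutation_self_in_orbit[OF f'])
  \<comment> \<open>The old cycle of \<open>a\<close> together with the arc from \<open>f b\<close>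
    to \<open>u\<close>. This set is closed under the new map, so it contains the new cycle of
    \<open>a\<close>.\<close>
  define P where "P = orbit f a \<union> (\<lambda>i. (f ^^ i) b) ` {0<..k}"
  have uP: "u \<in> P" unfolding P_def u_def using k(1) by auto
  have aP: "a \<in> P" unfolding P_def using selff by blast
  have fib: "(f ^^ i) b \<noteq> b" if i: "0 < i" "i \<le> k" for i
  proof
    assume eq: "(f ^^ i) b = b"
    then obtain j where j: "u = (f ^^ j) b" "j < i"
      using orbit_altdef_bounded[of i f b] i(1) uob by auto
    then have "0 < j" using ub by (cases j) auto
    then show False using k_least[of j] j k(2) i(2) by simp
  qed
  have bP: "b \<notin> P"
  proof
    assume "b \<in> P"
    then obtain i where "0 < i" "i \<le> k" "(f ^^ i) b = b" using ab unfolding P_def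
      by (metis (no_types, lifting) Un_iff greaterThanAtMost_iff imageE)
    then show False using fib by blast
  qed
  have closed: "?f z \<in> P" if zP: "z \<in> P" for z
  proof (cases "z = u")
    case True
    have "?f u = transpose a u (f b)" by simp
    moreover have "f b \<in> P" unfolding P_def using k(1) by (auto intro!: image_eqI[of _ _ "Suc 0"])
    ultimately show ?thesis using True aP uP by (auto simp: transpose_def)
  next
    case zu: False
    have zb: "z \<noteq> b" using zP bP by blast
    have "f z \<in> P"
    proof (cases "z \<in> orbit f a")
      case True
      then show ?thesis unfolding P_def by (auto intro: orbit.step)
    next
      case False
      then obtain i where i: "z = (f ^^ i) b" "0 < i" "i \<le> k" using zP unfolding P_def by auto
      then have "i < k" using zu by (auto simp: u_def le_less)
      then show ?thesis unfolding P_def using i by (auto intro!: image_eqI[of _ _ "Suc i"])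
    qed
    then show ?thesis using zu zb aP uP by (auto simp: transpose_def)
  qed
  have orbP: "orbit ?f a \<subseteq> P"
  proof
    fix z assume "z \<in> orbit ?f a"
    then show "z \<in> P" by induction (use closed aP in blast)+
  qed
  have SP: "S \<inter> P \<subseteq> {u}"
  proof
    fix z assume z: "z \<in> S \<inter> P"
    then have "z \<notin> orbit f a" using S(1) disj by blast
    then obtain i where i: "z = (f ^^ i) b" "0 < i" "i \<le> k" using z unfolding P_def by auto
    then have "k \<le> i" using k_least z by blast
    then show "z \<in> {u}" using i by (simp add: u_def)
  qed
  \<comment> \<open>On the old cycle of \<open>a\<close> the new map agrees with \<open>f\<close>,
    except that the predecessor of \<open>a\<close> is sent to \<open>u\<close>. If \<open>u\<close>
    were missed, the walk would cover the whole old cycle and hence reach that predecessor.\<close>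
  have u_in: "u \<in> orbit ?f a"
  proof (rule ccontr)
    assume nu: "u \<notin> orbit ?f a"
    have adv: "f z \<in> orbit ?f a" if "z \<in> orbit f a" "z \<in> orbit ?f a" for z
    proof -
      have "z \<noteq> b" "z \<noteq> u" using that disj selff uob by blast+
      moreover have "f z \<noteq> u" using orbit.step[OF that(1)] disj uob by blast
      ultimately show ?thesis
        using orbit.step[OF that(2)] selff'[of a] by (cases "f z = a") auto
    qed
    have sub: "z \<in> orbit ?f a" if "z \<in> orbit f a" for z
      using that
    proof induction
      case base
      show ?case by (rule adv[OF selff selff'])
    next
      case (step w)
      then show ?case by (rule adv)
    qed
    obtain z where z: "f z = a" using permutation_bijective[OF f] by (metis bij_pointE)
    then have "z \<in> orbit f a" using orbit_mem_sym[OF f] orbit.base[of f z] by simp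
    then have "z \<noteq> b" "z \<noteq> u" "z \<in> orbit ?f a" using disj selff uob sub by blast+
    then show False using orbit.step[of z ?f a] z nu by (simp add: o_def)
  qed
  define m where "m = funpow_dist1 f u b"
  have bou: "b \<in> orbit f u" using uob by (rule orbit_mem_sym[OF f])
  have m: "(f ^^ m) u = b" "0 < m" unfolding m_def using funpow_dist1_prop[OF bou] by auto
  have mu: "(f ^^ i) u \<noteq> u" if "0 < i" "i < m" for i
    using funpow_neq_less_funpow_dist1[OF bou, of i 0] that unfolding m_def by simp
  have mb: "(f ^^ i) u \<noteq> b" if "0 < i" "i < m" for i
    using funpow_dist1_least[of i f u b] that unfolding m_def by simp
  have na: "(f ^^ i) u \<noteq> a" for i
    using disj[OF selff] funpow_in_orbit[OF uob] by metis
  \<comment> \<open>The new map sends \<open>b\<close> to \<open>f u\<close> and agrees with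
    \<open>f\<close> from there on until it comes back to \<open>b\<close>, which is
    \<open>m\<close> steps after \<open>u\<close>.\<close>
  have tail: "(f ^^ Suc i) u \<in> orbit ?f b" if "Suc i \<le> m" for i
    using that
  proof (induction i)
    case 0
    have "f u \<noteq> u"
    proof
      assume "f u = u"
      then have "orbit f u = {u}" by (simp add: orbit_eq_singleton_iff)
      then show False using bou ub by simp
    qed
    then have "?f b = f u" using na[of 1] by simp
    then show ?case using orbit.base[of ?f b] by (simp add: o_def)
  next
    case (Suc i)
    have "(f ^^ Suc (Suc i)) u \<noteq> u"
      using mu[of "Suc (Suc i)"] m(1) ub Suc.prems by (cases "Suc (Suc i) = m") auto
    moreover have "(f ^^ Suc i) u \<noteq> u" "(f ^^ Suc i) u \<noteq> b"
      using mu[of "Suc i"] mb[of "Suc i"] Suc.prems by auto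
    ultimately have "?f ((f ^^ Suc i) u) = (f ^^ Suc (Suc i)) u"
      using na[of "Suc (Suc i)"] by simp
    then show ?case using orbit.step[OF Suc.IH] Suc.prems by (simp add: o_def)
  qed
  \<comment> \<open>Counted from \<open>b\<close>, the first visit to \<open>w\<close> comes after
    \<open>u\<close> and within the same turn, so \<open>w\<close> lies on the arc covered by
    \<open>tail\<close>.\<close>
  have rest: "w \<in> orbit ?f b" if w: "w \<in> S - {u}" for w
  proof (cases "w = b")
    case True
    then show ?thesis using selff' by blast
  next
    case False
    define j where "j = funpow_dist1 f b w"
    have wb: "w \<in> orbit f b" using w S by blast
    have j: "(f ^^ j) b = w" "0 < j" unfolding j_def using funpow_dist1_prop[OF wb] by auto
    have j_least: "(f ^^ i) b \<noteq> w" if "0 < i" "i < j" for i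
      using funpow_dist1_least[of i f b w] that unfolding j_def by simp
    have "k \<le> j" using k_least[of j] j w by simp
    moreover have "k \<noteq> j" using j w by (auto simp: u_def)
    ultimately have kj: "k < j" by simp
    then have eq: "(f ^^ (j - k)) u = w"
      using j(1) unfolding u_def by (metis comp_apply funpow_add le_add_diff_inverse2 less_imp_le)
    have "j - k \<le> m"
    proof (rule ccontr)
      assume "\<not> j - k \<le> m"
      then have lt: "m < j - k" by simp
      then have "(f ^^ (j - k - m)) b = w"
        using eq m(1) by (metis comp_apply funpow_add le_add_diff_inverse2 less_imp_le)
      moreover have "0 < j - k - m" "j - k - m < j" using lt m(2) by linarith+
      ultimately show False using j_least by blast
    qed
    moreover have "Suc (j - k - 1) = j - k" using kj by simp
    ultimately show ?thesis using tail[of "j - k - 1"] eq by metis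
  qed
  show ?thesis
    using k(2) ub u_in orbP bP SP rest by blast
qed

section \<open>Orbits avoiding a set and the two-to-one map\<close>

definition avoiding :: "'a set \<Rightarrow> 'a set \<Rightarrow> ('a \<Rightarrow> 'a) \<Rightarrow> nat" where
  "avoiding A S f = card {C \<in> orbit f ` A. C \<inter> S = {}}"

lemma cyc_eq_avoiding_plus:
  assumes "finite A"
  shows "cyc A f = avoiding A S f + card {C \<in> orbit f ` A. C \<inter> S \<noteq> {}}"
proof -
  have "orbit f ` A = {C \<in> orbit f ` A. C \<inter> S = {}} \<union> {C \<in> orbit f ` A. C \<inter> S \<noteq> {}}" by blast
  then have "cyc A f = card ({C \<in> orbit f ` A. C \<inter> S = {}} \<union> {C \<in> orbit f ` A. C \<inter> S \<noteq> {}})"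
    by (simp add: cyc_def)
  also have "\<dots> = avoiding A S f + card {C \<in> orbit f ` A. C \<inter> S \<noteq> {}}"
    unfolding avoiding_def using assms by (intro card_Un_disjoint) auto
  finally show ?thesis .
qed

lemma hitting_orbits_pos:
  assumes A: "finite A" and f: "f permutes A" and S: "S \<subseteq> A" "S \<noteq> {}"
  shows "0 < card {C \<in> orbit f ` A. C \<inter> S \<noteq> {}}"
proof -
  obtain v where v: "v \<in> S" using S by blast
  have "permutation f" using A f by (auto simp: permutation_permutes)
  then have "v \<in> orbit f v" by (rule permutation_self_in_orbit)
  then have "orbit f v \<in> {C \<in> orbit f ` A. C \<inter> S \<noteq> {}}" using v S by blast
  then show ?thesis using A by (auto simp: card_gt_0_iff)
qed

text \<open>At least one orbit meets the nonempty set \<open>S\<close>, which lowers the bound of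
  \<open>cyc_sum_le\<close> by one.\<close>

lemma avoiding_le:
  assumes A: "finite A" and D: "D permutes A" and s: "s permutes A" "cyclic_on s A"
    and S: "S \<subseteq> A" "S \<noteq> {}"
  shows "avoiding A S (inv D \<circ> s) + cyc A D \<le> card A"
proof -
  let ?f = "inv D \<circ> s"
  have f: "?f permutes A" using permutes_compose[OF s(1) permutes_inv[OF D]] .
  have "D \<circ> ?f = s" using permutes_inv_o[OF D] by (simp add: o_assoc)
  then have "cyc A D + cyc A ?f \<le> Suc (card A)" using cyc_sum_le[OF A D f] s(2) by simp
  then show ?thesis
    using cyc_eq_avoiding_plus[OF A, of ?f S] hitting_orbits_pos[OF A f S] by simp
qed

text \<open>These are the properties from which \<open>f\<close> is recovered: the equation for
  \<open>f'\<close> can be solved for \<open>f\<close> once \<open>a\<close> and \<open>u\<close>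
  are known, and \<open>u\<close> is determined by the new cycle of \<open>a\<close>.\<close>

definition transfer_of ::
  "'a set \<Rightarrow> 'a set \<Rightarrow> ('a \<Rightarrow> 'a) \<Rightarrow> ('a \<Rightarrow> 'a) \<Rightarrow> ('a \<Rightarrow> 'a) \<Rightarrow> 'a \<Rightarrow> 'a \<Rightarrow> bool" where
  "transfer_of A S D f f' a u \<longleftrightarrow> a \<in> A \<and> planar_pair A D f' \<and>
     f' = transpose a u \<circ> f \<circ> transpose (D a) u \<and>
     S \<inter> orbit f' a = {u} \<and> S - {u} \<subseteq> orbit f' (D a) \<and> D a \<notin> orbit f' a"

lemma ex_transfer:
  assumes pl: "planar_pair A D f" and D: "D \<noteq> id"
    and S: "S \<subseteq> A" "2 \<le> card S" and one: "card {C \<in> orbit f ` A. C \<inter> S \<noteq> {}} = 1"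
  shows "\<exists>f' a u. transfer_of A S D f f' a u"
proof -
  have A: "finite A" and DA: "D permutes A" and f: "f permutes A" and s: "cyclic_on (D \<circ> f) A"
    using pl by (auto simp: planar_pair_def)
  have pf: "permutation f" using A f by (auto simp: permutation_permutes)
  have selff: "x \<in> orbit f x" for x by (rule permutation_self_in_orbit[OF pf])
  obtain C where C: "{C \<in> orbit f ` A. C \<inter> S \<noteq> {}} = {C}" using one by (metis card_1_singletonE)
  have SC: "S \<subseteq> C"
  proof
    fix v assume v: "v \<in> S"
    then have "orbit f v \<in> {C \<in> orbit f ` A. C \<inter> S \<noteq> {}}" using S selff by blast
    then have "orbit f v = C" unfolding C by simp
    then show "v \<in> C" using selff by blast
  qed
  have "C \<in> orbit f ` A" using C by (metis (mono_tags, lifting) insertI1 mem_Collect_eq)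
  then obtain c where c: "c \<in> A" "C = orbit f c" by auto
  have CA: "C \<subseteq> A" using permutes_orbit_subset[OF f c(1)] c by blast
  \<comment> \<open>If \<open>D\<close> fixed \<open>C\<close> pointwise, then
    \<open>D \<circ> f\<close> would agree with \<open>f\<close> on \<open>C\<close>. So
    \<open>C\<close> would be closed under a full cycle, hence be all of \<open>A\<close>, and
    \<open>D\<close> would be the identity.\<close>
  have "\<exists>b\<in>C. D b \<noteq> b"
  proof (rule ccontr)
    assume nb: "\<not> (\<exists>b\<in>C. D b \<noteq> b)"
    have step: "(D \<circ> f) z = f z" if "z \<in> C" for z
      using that nb orbit.step[of z f c] c by auto
    have "orbit (D \<circ> f) c = orbit f c"
      using step c by (intro orbit_cong selff) blast
    then have "A = C" using s c by (simp add: orbit_cyclic_eq3)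
    then have "D z = z" for z using nb permutes_not_in[OF DA] by blast
    then show False using D by (auto simp: fun_eq_iff)
  qed
  then obtain b where b: "b \<in> C" "D b \<noteq> b" by blast
  define a where "a = inv D b"
  have Da: "D a = b" unfolding a_def using permutes_inverses[OF DA] by simp
  have ab: "b \<noteq> a" using b Da by auto
  have aA: "a \<in> A" using b CA Da permutes_in_image[OF DA] by blast
  have "b \<in> orbit D a" using Da orbit.base[of D a] by simp
  then have nb: "b \<notin> orbit f a" using planar_pair_orbits_meet[OF pl aA] ab by blast
  have Cb: "S \<subseteq> orbit f b" using SC b c orbit_eq_of_mem[OF pf] by metis
  have "\<not> S \<subseteq> {b}" using S(2) card_mono[of "{b}" S] by auto
  then obtain v where v: "v \<in> S" "v \<noteq> b" by blast
  obtain u where u: "u \<in> S" "u \<noteq> b"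
    "S \<inter> orbit (transpose a u \<circ> f \<circ> transpose b u) a = {u}"
    "S - {u} \<subseteq> orbit (transpose a u \<circ> f \<circ> transpose b u) b"
    "b \<notin> orbit (transpose a u \<circ> f \<circ> transpose b u) a"
    using orbit_separate_first[OF pf nb Cb v] by blast
  have "planar_pair A D (transpose a u \<circ> f \<circ> transpose b u)"
    using planar_pair_transfer[OF pl aA, of u] Da ab u Cb by auto
  then show ?thesis unfolding transfer_of_def using u aA Da by blast
qed

text \<open>The cycle of \<open>a\<close> contains \<open>u\<close>, and the cycle of
  \<open>D a\<close> contains the rest of \<open>S\<close>, which is nonempty because
  \<open>S\<close> has at least two elements.\<close>

lemma transfer_hitting_orbits:
  assumes t: "transfer_of A S D f f' a u" and S: "S \<subseteq> A" "2 \<le> card S"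
  shows "{C \<in> orbit f' ` A. C \<inter> S \<noteq> {}} = {orbit f' a, orbit f' (D a)}"
    and "orbit f' a \<noteq> orbit f' (D a)"
proof -
  have a: "a \<in> A" and pl: "planar_pair A D f'" and Su: "S \<inter> orbit f' a = {u}"
    and Sb: "S - {u} \<subseteq> orbit f' (D a)" and nb: "D a \<notin> orbit f' a"
    using t by (auto simp: transfer_of_def)
  have A: "finite A" and DA: "D permutes A" and f: "f' permutes A"
    using pl by (auto simp: planar_pair_def)
  have pf: "permutation f'" using A f by (auto simp: permutation_permutes)
  have selff: "x \<in> orbit f' x" for x by (rule permutation_self_in_orbit[OF pf])
  show "orbit f' a \<noteq> orbit f' (D a)" using nb selff by blast
  have b: "D a \<in> A" using a permutes_in_image[OF DA] by blast
  have "\<not> S \<subseteq> {u}" using S(2) card_mono[of "{u}" S] by auto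
  then obtain v where v: "v \<in> S" "v \<noteq> u" by blast
  have "C = orbit f' a \<or> C = orbit f' (D a)" if C: "C \<in> orbit f' ` A" "C \<inter> S \<noteq> {}" for C
  proof -
    obtain w where w: "w \<in> S" "w \<in> C" using C(2) by blast
    have "C = orbit f' w" using C(1) w(2) orbit_eq_of_mem[OF pf] by blast
    moreover have "w \<in> orbit f' a \<or> w \<in> orbit f' (D a)" using w(1) Su Sb by blast
    ultimately show ?thesis using orbit_eq_of_mem[OF pf] by blast
  qed
  moreover have "orbit f' a \<inter> S \<noteq> {}" using Su by blast
  moreover have "orbit f' (D a) \<inter> S \<noteq> {}" using v Sb by blast
  ultimately show "{C \<in> orbit f' ` A. C \<inter> S \<noteq> {}} = {orbit f' a, orbit f' (D a)}"
    using a b by blast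
qed

text \<open>Exactly two orbits of \<open>f'\<close> meet \<open>S\<close>, so knowing that of
  \<open>a\<close> also gives that of \<open>D a\<close>. Then
  \<open>planar_pair_step_unique\<close> determines \<open>a\<close>, and \<open>u\<close> is the
  only element of \<open>S\<close> in the orbit of \<open>a\<close>.\<close>

lemma transfer_unique:
  assumes t: "transfer_of A S D f f' a u" and t': "transfer_of A S D g f' a' u'"
    and S: "S \<subseteq> A" "2 \<le> card S" and eq: "orbit f' a = orbit f' a'"
  shows "f = g"
proof -
  have a: "a \<in> A" and pl: "planar_pair A D f'" and nb: "D a \<notin> orbit f' a"
    using t by (auto simp: transfer_of_def)
  have A: "finite A" and f: "f' permutes A"
    using pl by (auto simp: planar_pair_def)
  have pf: "permutation f'" using A f by (auto simp: permutation_permutes)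
  have selff: "x \<in> orbit f' x" for x by (rule permutation_self_in_orbit[OF pf])
  have "orbit f' (D a') = orbit f' (D a)"
    using transfer_hitting_orbits[OF t S] transfer_hitting_orbits[OF t' S] eq by (auto simp: doubleton_eq_iff)
  then have "D a' \<in> orbit f' (D a)" "a' \<in> orbit f' a" using selff eq by blast+
  then have aa: "a' = a" using planar_pair_step_unique[OF pl a] nb by blast
  then have uu: "u' = u" using t t' by (auto simp: transfer_of_def)
  have "f = transpose a u \<circ> f' \<circ> transpose (D a) u"
    using t by (auto simp: transfer_of_def fun_eq_iff)
  moreover have "g = transpose a u \<circ> f' \<circ> transpose (D a) u"
    using t' aa uu by (auto simp: transfer_of_def fun_eq_iff)
  ultimately show ?thesis by simp
qed

text \<open>Choose a transfer \<phi> for each top configuration. Within a fibre of \<phi>, the orbit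
  of the chosen \<open>a\<close> determines the configuration and is one of the two orbits that meet
  \<open>S\<close>.\<close>

lemma card_top_le_twice_next:
  assumes A: "finite A" and D: "D permutes A" "D \<noteq> id"
    and S: "S \<subseteq> A" "2 \<le> card S"
  shows "card {s. s permutes A \<and> cyclic_on s A \<and> avoiding A S (inv D \<circ> s) + cyc A D = card A}
    \<le> 2 * card {s. s permutes A \<and> cyclic_on s A \<and> Suc (avoiding A S (inv D \<circ> s)) + cyc A D = card A}"
    (is "card ?X \<le> 2 * card ?Y")
proof -
  define X where "X = ?X"
  define Y where "Y = ?Y"
  have S0: "S \<noteq> {}" using S by auto
  have "\<exists>s' a u. transfer_of A S D (inv D \<circ> s) (inv D \<circ> s') a u \<and> s' \<in> Y" if "s \<in> X" for s
  proof -
    let ?f = "inv D \<circ> s"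
    have s: "s permutes A" "cyclic_on s A" "avoiding A S ?f + cyc A D = card A" using that by (auto simp: X_def)
    have f: "?f permutes A" using permutes_compose[OF s(1) permutes_inv[OF D(1)]] .
    have Df: "D \<circ> ?f = s" using permutes_inv_o[OF D(1)] by (simp add: o_assoc)
    have "cyc A D + cyc A ?f \<le> Suc (card A)" using cyc_sum_le[OF A D(1) f] s(2) Df by simp
    \<comment> \<open>At least one orbit meets \<open>S\<close>, and the total count is bounded by
      \<open>cyc_sum_le\<close>; the top value leaves equality in both.\<close>
    then have one: "card {C \<in> orbit ?f ` A. C \<inter> S \<noteq> {}} = 1" and sum: "cyc A D + cyc A ?f = Suc (card A)"
      using cyc_eq_avoiding_plus[OF A, of ?f S] hitting_orbits_pos[OF A f S(1) S0] s(3) by linarith+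
    have pl: "planar_pair A D ?f"
      unfolding planar_pair_def using A D(1) f s(2) Df sum by simp
    obtain f' a u where t: "transfer_of A S D ?f f' a u"
      using ex_transfer[OF pl D(2) S one] by blast
    define s' where "s' = D \<circ> f'"
    have f's: "inv D \<circ> s' = f'" unfolding s'_def using permutes_inv_o[OF D(1)] by (simp add: o_assoc)
    have pl': "planar_pair A D f'" using t unfolding transfer_of_def by blast
    then have f'A: "f' permutes A" and s'c: "cyclic_on s' A" and sum': "cyc A D + cyc A f' = Suc (card A)"
      by (auto simp: planar_pair_def s'_def)
    have s'A: "s' permutes A" unfolding s'_def using permutes_compose[OF f'A D(1)] .
    have "card {C \<in> orbit f' ` A. C \<inter> S \<noteq> {}} = 2"
      using transfer_hitting_orbits[OF t S] by simp
    then have "Suc (avoiding A S f') + cyc A D = card A"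
      using cyc_eq_avoiding_plus[OF A, of f' S] sum' by simp
    then have Y: "s' \<in> Y" using s'A s'c f's by (simp add: Y_def)
    have "transfer_of A S D ?f (inv D \<circ> s') a u" unfolding f's by (rule t)
    then show ?thesis using Y by (intro exI conjI)
  qed
  then obtain \<phi> \<alpha> \<upsilon> where
    \<phi>: "\<And>s. s \<in> X \<Longrightarrow> transfer_of A S D (inv D \<circ> s) (inv D \<circ> \<phi> s) (\<alpha> s) (\<upsilon> s) \<and> \<phi> s \<in> Y"
    by metis
  have finX: "finite X" and finY: "finite Y"
    unfolding X_def Y_def using finite_permutations[OF A] by (auto intro: rev_finite_subset)
  have fib: "card {s \<in> X. \<phi> s = y} \<le> 2" for y
  proof (cases "{s \<in> X. \<phi> s = y} = {}")
    case True
    then show ?thesis by (metis card.empty zero_le)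
  next
    case False
    then obtain t where t: "t \<in> X" "\<phi> t = y" by blast
    let ?g = "inv D \<circ> y"
    let ?H = "{C \<in> orbit ?g ` A. C \<inter> S \<noteq> {}}"
    have tt: "transfer_of A S D (inv D \<circ> t) ?g (\<alpha> t) (\<upsilon> t)" using \<phi>[OF t(1)] t(2) by simp
    have H: "card ?H = 2" "finite ?H"
      using transfer_hitting_orbits[OF tt S] by simp_all
    have "inj_on (\<lambda>s. orbit ?g (\<alpha> s)) {s \<in> X. \<phi> s = y}"
    proof (rule inj_onI)
      fix r s assume r: "r \<in> {s \<in> X. \<phi> s = y}" and s: "s \<in> {s \<in> X. \<phi> s = y}"
        and eq: "orbit ?g (\<alpha> r) = orbit ?g (\<alpha> s)"
      have "transfer_of A S D (inv D \<circ> r) ?g (\<alpha> r) (\<upsilon> r)"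
        "transfer_of A S D (inv D \<circ> s) ?g (\<alpha> s) (\<upsilon> s)"
        using \<phi>[of r] \<phi>[of s] r s by simp_all
      then have "inv D \<circ> r = inv D \<circ> s" using eq by (rule transfer_unique[OF _ _ S])
      then have "D \<circ> inv D \<circ> r = D \<circ> inv D \<circ> s" by (simp only: comp_assoc)
      then show "r = s" using permutes_inv_o[OF D(1)] by simp
    qed
    moreover have "(\<lambda>s. orbit ?g (\<alpha> s)) ` {s \<in> X. \<phi> s = y} \<subseteq> ?H"
    proof
      fix C assume "C \<in> (\<lambda>s. orbit ?g (\<alpha> s)) ` {s \<in> X. \<phi> s = y}"
      then obtain r where r: "r \<in> X" "\<phi> r = y" "C = orbit ?g (\<alpha> r)" by blast
      have "transfer_of A S D (inv D \<circ> r) ?g (\<alpha> r) (\<upsilon> r)" using \<phi>[OF r(1)] r(2) by simp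
      from transfer_hitting_orbits(1)[OF this S] show "C \<in> ?H" unfolding r(3) by blast
    qed
    ultimately have "card {s \<in> X. \<phi> s = y} \<le> card ?H" using H(2) by (rule card_inj_on_le)
    then show ?thesis unfolding H(1) .
  qed
  have "X = (\<Union>y\<in>Y. {s \<in> X. \<phi> s = y})" using \<phi> by blast
  then have "card X \<le> (\<Sum>y\<in>Y. card {s \<in> X. \<phi> s = y})" using card_UN_le[OF finY] by metis
  also have "\<dots> \<le> (\<Sum>y\<in>Y. 2)" by (rule sum_mono) (rule fib)
  finally show ?thesis by (simp add: X_def Y_def)
qed

section \<open>Components of a bijection\<close>

abbreviation graph_comp :: "'a set \<Rightarrow> ('a \<Rightarrow> 'a) \<Rightarrow> 'a \<Rightarrow> 'a set" where
  "graph_comp X g x \<equiv> (graph_edges X g \<union> (graph_edges X g)\<inverse>)\<^sup>* `` {x}"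

lemma graph_components_altdef: "graph_components X Y g = graph_comp X g ` (X \<union> Y)"
  unfolding graph_components_def quotient_def by blast

lemma graph_comp_self: "x \<in> graph_comp X g x"
  by simp

lemma graph_comp_eq:
  assumes "y \<in> graph_comp X g x"
  shows "graph_comp X g y = graph_comp X g x"
proof -
  let ?E = "graph_edges X g \<union> (graph_edges X g)\<inverse>"
  have "sym (?E\<^sup>*)" by (intro sym_rtrancl) (auto simp: sym_def)
  then have "equiv UNIV (?E\<^sup>*)" by (auto simp: equiv_def refl_rtrancl trans_rtrancl)
  moreover have "(x, y) \<in> ?E\<^sup>*" using assms by simp
  ultimately show ?thesis using equiv_class_eq by metis
qed

lemma graph_comp_image_eq:
  assumes "x \<in> X"
  shows "graph_comp X g (g x) = graph_comp X g x"
proof (rule graph_comp_eq)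
  have "(x, g x) \<in> graph_edges X g" using assms by (auto simp: graph_edges_def)
  then show "g x \<in> graph_comp X g x" by blast
qed

lemma graph_comp_subset:
  assumes "x \<in> Z" "\<And>z. z \<in> Z \<Longrightarrow> z \<in> X \<Longrightarrow> g z \<in> Z" "\<And>z. z \<in> X \<Longrightarrow> g z \<in> Z \<Longrightarrow> z \<in> Z"
  shows "graph_comp X g x \<subseteq> Z"
proof
  fix y assume "y \<in> graph_comp X g x"
  then have "(x, y) \<in> (graph_edges X g \<union> (graph_edges X g)\<inverse>)\<^sup>*" by simp
  then show "y \<in> Z"
    by induction (use assms in \<open>auto simp: graph_edges_def\<close>)
qed

section \<open>Paths and cycles of the graph of a bijection\<close>

locale finite_bij =
  fixes X Y :: "'a set" and g :: "'a \<Rightarrow> 'a"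
  assumes finX: "finite X" and finY: "finite Y" and bij: "bij_betw g X Y"
begin

lemma inj: "inj_on g X" and img: "g ` X = Y"
  using bij by (auto simp: bij_betw_def)

lemma comp_subset: "x \<in> X \<union> Y \<Longrightarrow> graph_comp X g x \<subseteq> X \<union> Y"
  by (rule graph_comp_subset) (use img in auto)

lemma finite_components: "finite (graph_components X Y g)"
  unfolding graph_components_altdef using finX finY by simp

lemma component_eq_comp:
  assumes "C \<in> graph_components X Y g" "x \<in> C"
  shows "C = graph_comp X g x"
  using assms graph_comp_eq[of x X g] unfolding graph_components_altdef by blast

lemma comp_in_components: "x \<in> X \<union> Y \<Longrightarrow> graph_comp X g x \<in> graph_components X Y g"
  unfolding graph_components_altdef by blast

text \<open>A start \<open>x\<close> has no preimage, while injectivity lets an equality of two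
  iterates be pulled back to one that involves \<open>x\<close> itself.\<close>

lemma iterates_distinct:
  assumes x: "x \<in> X - Y" and "i < j" "\<And>l. l < j \<Longrightarrow> (g ^^ l) x \<in> X"
  shows "(g ^^ i) x \<noteq> (g ^^ j) x"
  using assms(2,3)
proof (induction i arbitrary: j)
  case 0
  then obtain j' where "j = Suc j'" by (cases j) auto
  then have "(g ^^ j) x \<in> Y" using 0(2)[of j'] img by auto
  then show ?case using x by auto
next
  case (Suc i)
  then obtain j' where j: "j = Suc j'" by (cases j) auto
  have "(g ^^ i) x \<noteq> (g ^^ j') x" using Suc.IH[of j'] Suc.prems j by simp
  moreover have "(g ^^ i) x \<in> X" "(g ^^ j') x \<in> X" using Suc.prems j by simp_all
  ultimately show ?case using inj j by (auto dest: inj_onD)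
qed

lemma path_component:
  assumes x: "x \<in> X - Y"
  shows "is_dipath (graph_edges X g) (graph_comp X g x)"
    and "graph_comp X g x \<inter> (X - Y) = {x}"
    and "graph_comp X g x \<inter> (Y - X) \<noteq> {}"
proof -
  have "\<exists>i. (g ^^ i) x \<notin> X"
  proof (rule ccontr)
    assume "\<not> (\<exists>i. (g ^^ i) x \<notin> X)"
    then have all: "(g ^^ i) x \<in> X" for i by blast
    have "inj (\<lambda>i. (g ^^ i) x)"
      using iterates_distinct[OF x _ all] by (intro injI) (metis linorder_neqE_nat)
    moreover have "range (\<lambda>i. (g ^^ i) x) \<subseteq> X" using all by auto
    ultimately show False using finX by (meson finite_imageD finite_subset infinite_UNIV_nat)
  qed
  \<comment> \<open>The first exit from \<open>X\<close>. It exists because pairwise distinct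
    iterates cannot all stay in a finite set. The path is the list of iterates up to and including
    this one.\<close>
  define m where "m = (LEAST i. (g ^^ i) x \<notin> X)"
  have m: "(g ^^ m) x \<notin> X" unfolding m_def by (rule LeastI_ex) fact
  have lt: "(g ^^ i) x \<in> X" if "i < m" for i using not_less_Least that unfolding m_def by blast
  have m0: "0 < m" using m x by (cases m) auto
  define xs where "xs = map (\<lambda>i. (g ^^ i) x) [0..<Suc m]"
  have nth: "xs ! i = (g ^^ i) x" if "i \<le> m" for i
    unfolding xs_def using that by (simp del: upt_Suc)
  have len: "length xs = Suc m" by (simp add: xs_def)
  have set_xs: "set xs = {(g ^^ i) x |i. i \<le> m}" unfolding xs_def set_map set_upt by (auto simp: less_Suc_eq_le)
  have inj_it: "i = j" if "(g ^^ i) x = (g ^^ j) x" "i \<le> m" "j \<le> m" for i j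
    using iterates_distinct[OF x, of i j] iterates_distinct[OF x, of j i] lt that
    by (metis linorder_neqE_nat order_less_le_trans)
  have dist: "distinct xs"
    unfolding distinct_conv_nth len using inj_it nth by (simp add: less_Suc_eq_le) metis
  let ?C = "graph_comp X g x"
  have inC: "(g ^^ i) x \<in> ?C" if "i \<le> m" for i
    using that
  proof (induction i)
    case 0
    then show ?case using graph_comp_self by simp
  next
    case (Suc i)
    then have "(g ^^ i) x \<in> X" using lt by simp
    from graph_comp_image_eq[OF this, of g] graph_comp_eq[of "(g ^^ i) x" X g x] Suc
    have "graph_comp X g ((g ^^ Suc i) x) = ?C" by simp
    then show ?case using graph_comp_self[of "(g ^^ Suc i) x" X g] by simp
  qed
  have "?C \<subseteq> set xs"
  proof (rule graph_comp_subset)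
    show "x \<in> set xs" unfolding set_xs by (auto intro!: exI[of _ 0])
  next
    fix z assume "z \<in> set xs" "z \<in> X"
    then obtain i where i: "z = (g ^^ i) x" "i \<le> m" unfolding set_xs by blast
    then have "i < m" using m \<open>z \<in> X\<close> by (auto simp: le_less)
    then show "g z \<in> set xs" unfolding set_xs using i by (auto intro!: exI[of _ "Suc i"])
  next
    fix z assume z: "z \<in> X" "g z \<in> set xs"
    then obtain i where i: "g z = (g ^^ i) x" "i \<le> m" unfolding set_xs by blast
    have "i \<noteq> 0" using i z img x by (cases "i = 0") auto
    then obtain i' where i': "i = Suc i'" by (cases i) auto
    then have "z = (g ^^ i') x" using i z lt[of i'] inj by (auto dest: inj_onD)
    then show "z \<in> set xs" unfolding set_xs using i i' by (auto intro!: exI[of _ i'])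
  qed
  then have C: "set xs = ?C" using inC unfolding set_xs by blast
  have "graph_edges X g \<inter> ?C \<times> ?C = {(xs ! i, xs ! Suc i) |i. Suc i < length xs}" (is "?L = ?R")
  proof
    show "?L \<subseteq> ?R"
    proof
      fix e assume "e \<in> ?L"
      then obtain z where z: "e = (z, g z)" "z \<in> X" "z \<in> set xs" unfolding C graph_edges_def by blast
      then obtain i where i: "z = (g ^^ i) x" "i \<le> m" unfolding set_xs by blast
      then have "i < m" using m z by (auto simp: le_less)
      then show "e \<in> ?R" using z i nth[of i] nth[of "Suc i"] len by (auto intro!: exI[of _ i])
    qed
    show "?R \<subseteq> ?L"
    proof
      fix e assume "e \<in> ?R"
      then obtain i where i: "e = (xs ! i, xs ! Suc i)" "i < m" unfolding len by auto
      then have "e = ((g ^^ i) x, g ((g ^^ i) x))" using nth by simp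
      moreover have "(g ^^ i) x \<in> ?C" "g ((g ^^ i) x) \<in> ?C"
        using inC[of i] inC[of "Suc i"] i by simp_all
      ultimately show "e \<in> ?L" using lt[OF i(2)] unfolding graph_edges_def by blast
    qed
  qed
  then show "is_dipath (graph_edges X g) ?C"
    unfolding is_dipath_def using dist C len by (intro exI[of _ xs]) auto
  have inY: "(g ^^ i) x \<in> Y" if "0 < i" "i \<le> m" for i
    using that lt[of "i - 1"] img by (cases i) auto
  show "?C \<inter> (Y - X) \<noteq> {}" using inY[of m] m0 inC[of m] m by blast
  show "?C \<inter> (X - Y) = {x}"
  proof
    show "{x} \<subseteq> ?C \<inter> (X - Y)" using x graph_comp_self by simp
    show "?C \<inter> (X - Y) \<subseteq> {x}"
    proof
      fix z assume z: "z \<in> ?C \<inter> (X - Y)"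
      then obtain i where i: "z = (g ^^ i) x" "i \<le> m" using C unfolding set_xs by blast
      then have "i = 0" using inY[of i] z by (cases i) auto
      then show "z \<in> {x}" using i by simp
    qed
  qed
qed

text \<open>Without a start, every vertex of \<open>C\<close> has a predecessor, which again lies in
  \<open>C\<close>. So \<open>g\<close> maps \<open>C \<inter> X\<close> onto a superset of
  \<open>C\<close>, and counting forces \<open>C \<subseteq> X\<close>.\<close>

lemma cycle_component_bij:
  assumes C: "C \<in> graph_components X Y g" "C \<inter> (X - Y) = {}"
  shows "C \<subseteq> X \<inter> Y" and "bij_betw g C C"
proof -
  obtain x where x: "x \<in> X \<union> Y" "C = graph_comp X g x"
    using C(1) unfolding graph_components_altdef by blast
  have CXY: "C \<subseteq> X \<union> Y" using comp_subset x by simp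
  then have CY: "C \<subseteq> Y" using C(2) by blast
  have fin: "finite C" using CY finY by (rule finite_subset)
  have "C \<subseteq> g ` (C \<inter> X)"
  proof
    fix z assume z: "z \<in> C"
    then obtain w where w: "w \<in> X" "z = g w" using CY img by blast
    then have "graph_comp X g w = C"
      using graph_comp_image_eq[of w X g] component_eq_comp[OF C(1) z] by simp
    then have "w \<in> C" using graph_comp_self[of w X g] by simp
    then show "z \<in> g ` (C \<inter> X)" using w by blast
  qed
  then have "card C \<le> card (C \<inter> X)" using fin by (metis surj_card_le finite_Int)
  then have CX: "C \<inter> X = C" using fin by (metis Int_lower1 card_seteq)
  then show "C \<subseteq> X \<inter> Y" using CY by blast
  have "g z \<in> C" if "z \<in> C" for z
    using component_eq_comp[OF C(1) that] CX that graph_comp_image_eq[of z X g]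
      graph_comp_self[of "g z" X g] by blast
  then have "g ` C = C" using \<open>C \<subseteq> g ` (C \<inter> X)\<close> CX by auto
  moreover have "inj_on g C" using inj CX by (metis inf.orderI inf_commute inj_on_subset)
  ultimately show "bij_betw g C C" by (simp add: bij_betw_def)
qed

lemma cycle_component:
  assumes C: "C \<in> graph_components X Y g" "C \<inter> (X - Y) = {}"
  shows "is_dicycle (graph_edges X g) C"
proof -
  obtain x where x: "x \<in> X \<union> Y" "C = graph_comp X g x"
    using C(1) unfolding graph_components_altdef by blast
  have sub: "C \<subseteq> X \<inter> Y" and bij': "bij_betw g C C" using cycle_component_bij[OF C] by auto
  \<comment> \<open>The extension by the identity makes \<open>g\<close> on \<open>C\<close> a
    permutation. Connectedness shows that \<open>C\<close> is a single orbit of it, and listing that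
    orbit from \<open>x\<close> gives the directed cycle.\<close>
  define p where "p = restrict_id g C"
  have pC: "p permutes C" unfolding p_def using bij' by (rule permutes_restrict_id)
  have pg: "p z = g z" if "z \<in> C" for z using that by (simp add: p_def)
  have fin: "finite C" using sub finX by (meson finite_subset le_infE)
  then have perm: "permutation p" using pC by (auto simp: permutation_permutes)
  have xC: "x \<in> C" using x graph_comp_self by simp
  have self: "x \<in> orbit p x" by (rule permutation_self_in_orbit[OF perm])
  have orbC: "orbit p x \<subseteq> C" using permutes_orbit_subset[OF pC xC] .
  have "C \<subseteq> orbit p x"
    unfolding x(2)
  proof (rule graph_comp_subset[OF self])
    fix z assume "z \<in> orbit p x" "z \<in> X"
    then show "g z \<in> orbit p x" using pg[of z] orbC orbit.step[of z p x] by auto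
  next
    fix z assume z: "z \<in> X" "g z \<in> orbit p x"
    then have "g z \<in> g ` C" using orbC bij' by (auto simp: bij_betw_def)
    then have "z \<in> C" using inj sub z by (auto dest: inj_onD)
    then have "p z \<in> orbit p x" using z pg by simp
    then show "z \<in> orbit p x"
      using orbit_mem_sym[OF perm orbit.base[of p z]] orbit_trans by metis
  qed
  then have orb: "orbit p x = C" using orbC by blast
  define n where "n = funpow_dist1 p x x"
  define xs where "xs = map (\<lambda>i. (p ^^ i) x) [0..<n]"
  have n: "0 < n" "(p ^^ n) x = x" unfolding n_def using funpow_dist1_prop[OF self] by auto
  have set_xs: "set xs = C"
    unfolding xs_def set_map set_upt n_def
    using orbit_conv_funpow_dist1[OF self, symmetric] orb by (rule trans)
  have dist: "distinct xs"
    unfolding xs_def distinct_map set_upt n_def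
    using inj_on_funpow_dist1[OF self] by (intro conjI distinct_upt)
  have len: "length xs = n" by (simp add: xs_def)
  have nth: "xs ! i = (p ^^ i) x" if "i < n" for i using that by (simp add: xs_def)
  have nxt: "xs ! (Suc i mod n) = g (xs ! i)" if "i < n" for i
  proof -
    have "xs ! i \<in> C" using that len set_xs nth_mem by metis
    then have "g (xs ! i) = (p ^^ Suc i) x" using nth[OF that] pg by simp
    moreover have "xs ! (Suc i mod n) = (p ^^ Suc i) x"
    proof (cases "Suc i = n")
      case True
      then show ?thesis using n nth[of 0] by (metis funpow_0 mod_self)
    next
      case False
      then show ?thesis using that nth[of "Suc i"] by simp
    qed
    ultimately show ?thesis by simp
  qed
  have "graph_edges X g \<inter> C \<times> C = {(z, g z) |z. z \<in> C}"
    unfolding graph_edges_def using sub bij' by (auto simp: bij_betw_def)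
  also have "\<dots> = {(xs ! i, xs ! (Suc i mod n)) |i. i < n}"
  proof -
    have "{(z, g z) |z. z \<in> C} = {(xs ! i, g (xs ! i)) |i. i < n}"
      unfolding set_xs[symmetric] len[symmetric] by (auto simp: in_set_conv_nth)
    also have "\<dots> = {(xs ! i, xs ! (Suc i mod n)) |i. i < n}" using nxt by metis
    finally show ?thesis .
  qed
  finally show ?thesis
    unfolding is_dicycle_def using dist set_xs len n(1) by (intro exI[of _ xs]) auto
qed

lemma dicycle_no_start:
  assumes "is_dicycle (graph_edges X g) C"
  shows "C \<inter> (X - Y) = {}"
proof -
  obtain xs where xs: "xs \<noteq> []" "set xs = C"
    "graph_edges X g \<inter> C \<times> C = {(xs ! i, xs ! (Suc i mod length xs)) | i. i < length xs}"
    using assms unfolding is_dicycle_def by blast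
  have "z \<in> Y" if z: "z \<in> C" for z
  proof -
    let ?n = "length xs"
    obtain j where j: "j < ?n" "z = xs ! j" using z xs(2) by (metis in_set_conv_nth)
    define i where "i = (if j = 0 then ?n - 1 else j - 1)"
    have i: "i < ?n" "Suc i mod ?n = j" using j by (auto simp: i_def)
    then have "(xs ! i, z) \<in> graph_edges X g" using xs(3) j by blast
    then show ?thesis using img by (auto simp: graph_edges_def)
  qed
  then show ?thesis by blast
qed

text \<open>Otherwise \<open>g\<close> permutes \<open>C\<close>, so the head of the list has a
  predecessor in \<open>C\<close>; but every edge of a directed path enters a later entry of the
  list.\<close>

lemma dipath_start:
  assumes C: "C \<in> graph_components X Y g" and "is_dipath (graph_edges X g) C"
  shows "C \<inter> (X - Y) \<noteq> {}"
proof
  assume nost: "C \<inter> (X - Y) = {}"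
  obtain xs where xs: "xs \<noteq> []" "distinct xs" "set xs = C"
    "graph_edges X g \<inter> C \<times> C = {(xs ! i, xs ! Suc i) | i. Suc i < length xs}"
    using assms(2) unfolding is_dipath_def by blast
  have sub: "C \<subseteq> X \<inter> Y" and b: "bij_betw g C C" using cycle_component_bij[OF C nost] by auto
  have h: "xs ! 0 \<in> C" using xs by auto
  then have "xs ! 0 \<in> g ` C" using b by (simp add: bij_betw_def)
  then obtain w where w: "w \<in> C" "g w = xs ! 0" by (metis imageE)
  then have "(w, xs ! 0) \<in> graph_edges X g \<inter> C \<times> C"
    using sub h by (force simp: graph_edges_def)
  then obtain i where "xs ! 0 = xs ! Suc i" "Suc i < length xs" unfolding xs(4) by blast
  then show False using xs(1,2) nth_eq_iff_index_eq[of xs 0 "Suc i"] by simp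
qed

lemma path_components_eq:
  "path_components X Y g = {C \<in> graph_components X Y g. C \<inter> (X - Y) \<noteq> {}}"
proof -
  have "is_dipath (graph_edges X g) C" if C: "C \<in> graph_components X Y g" "C \<inter> (X - Y) \<noteq> {}" for C
  proof -
    obtain x where x: "x \<in> C" "x \<in> X - Y" using C(2) by blast
    show ?thesis using path_component(1)[OF x(2)] component_eq_comp[OF C(1) x(1)] by simp
  qed
  then show ?thesis unfolding path_components_def using dipath_start by blast
qed

lemma cycle_components_eq:
  "cycle_components X Y g = {C \<in> graph_components X Y g. C \<inter> (X - Y) = {}}"
  unfolding cycle_components_def using dicycle_no_start cycle_component by blast

lemma card_path_components: "card (path_components X Y g) = card (X - Y)"
proof -
  have "path_components X Y g = graph_comp X g ` (X - Y)"
  proof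
    show "path_components X Y g \<subseteq> graph_comp X g ` (X - Y)"
      unfolding path_components_eq using component_eq_comp by blast
    show "graph_comp X g ` (X - Y) \<subseteq> path_components X Y g"
      unfolding path_components_eq using path_component(2) comp_in_components by blast
  qed
  moreover have "inj_on (graph_comp X g) (X - Y)"
    by (rule inj_onI) (metis path_component(2) singleton_inject)
  ultimately show ?thesis by (simp add: card_image)
qed

lemma num_components_eq:
  "num_components X Y g = card (X - Y) + card (cycle_components X Y g)"
proof -
  have "graph_components X Y g = path_components X Y g \<union> cycle_components X Y g"
    unfolding path_components_eq cycle_components_eq by blast
  moreover have "path_components X Y g \<inter> cycle_components X Y g = {}"
    unfolding path_components_eq cycle_components_eq by blast
  moreover have "finite (path_components X Y g)" "finite (cycle_components X Y g)"
    unfolding path_components_eq cycle_components_eq using finite_components by auto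
  ultimately show ?thesis
    unfolding num_components_def using card_path_components by (simp add: card_Un_disjoint)
qed

lemma length_component_type:
  assumes "component_type X Y g = (lam, mu)"
  shows "length lam = card (X - Y)" and "length mu = card (cycle_components X Y g)"
proof -
  have len: "length (rev (sorted_list_of_multiset M)) = size M" for M :: "nat multiset"
    by (metis length_rev mset_sorted_list_of_multiset size_mset)
  show "length lam = card (X - Y)" "length mu = card (cycle_components X Y g)"
    using assms card_path_components len unfolding component_type_def by auto
qed

text \<open>Cycles of \<open>g\<close> survive the identification of path ends with path starts by \<open>J\<close>, and paths
  get linked up into cycles through \<open>X - Y\<close>.\<close>

lemma cycle_components_eq_orbits:
  assumes J: "\<And>y. y \<in> X \<inter> Y \<Longrightarrow> J y = y" "\<And>y. y \<in> Y - X \<Longrightarrow> J y \<in> X - Y"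
    and h: "h permutes X" "\<And>x. x \<in> X \<Longrightarrow> h x = J (g x)"
  shows "cycle_components X Y g = {C \<in> orbit h ` X. C \<inter> (X - Y) = {}}"
proof -
  have ph: "permutation h" using finX h(1) by (auto simp: permutation_permutes)
  have key: "graph_comp X g x = orbit h x" if x: "x \<in> X" "orbit h x \<inter> (X - Y) = {}" for x
  proof
    have sub: "orbit h x \<subseteq> X \<inter> Y" using permutes_orbit_subset[OF h(1) x(1)] x(2) by blast
    \<comment> \<open>\<open>J\<close> changes only path ends, and it sends these into
      \<open>X - Y\<close>, which the orbit of \<open>x\<close> avoids.\<close>
    have same: "h z = g z" if "z \<in> X" "h z \<in> orbit h x \<or> g z \<in> orbit h x" for z
    proof -
      have "g z \<in> Y" using that img by blast
      then show ?thesis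
        using that h(2)[of z] sub J(1)[of "g z"] J(2)[of "g z"] by (cases "g z \<in> X") auto
    qed
    show "graph_comp X g x \<subseteq> orbit h x"
    proof (rule graph_comp_subset)
      show "x \<in> orbit h x" by (rule permutation_self_in_orbit[OF ph])
    next
      fix z assume "z \<in> orbit h x" "z \<in> X"
      then show "g z \<in> orbit h x" using same[of z] orbit.step[of z h x] by simp
    next
      fix z assume "z \<in> X" "g z \<in> orbit h x"
      then have "h z \<in> orbit h x" using same[of z] by simp
      then show "z \<in> orbit h x" using orbit_mem_sym[OF ph orbit.base[of h z]] orbit_trans by metis
    qed
    have stp: "graph_comp X g (h z) = graph_comp X g z" if "z \<in> X" "h z \<in> orbit h x" for z
      using same[of z] that graph_comp_image_eq[of z X g] by simp
    show "orbit h x \<subseteq> graph_comp X g x"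
    proof
      fix z assume "z \<in> orbit h x"
      then have "graph_comp X g z = graph_comp X g x"
      proof induction
        case base
        then show ?case using stp[OF x(1) orbit.base] .
      next
        case (step z)
        then show ?case using stp[of z] orbit.step[OF step.hyps] sub by blast
      qed
      then show "z \<in> graph_comp X g x" using graph_comp_self[of z X g] by blast
    qed
  qed
  show ?thesis
  proof
    show "{C \<in> orbit h ` X. C \<inter> (X - Y) = {}} \<subseteq> cycle_components X Y g"
    proof
      fix C assume C: "C \<in> {C \<in> orbit h ` X. C \<inter> (X - Y) = {}}"
      then obtain x where x: "x \<in> X" "C = orbit h x" by blast
      then have "C = graph_comp X g x" using key[of x] C by simp
      then show "C \<in> cycle_components X Y g"
        unfolding cycle_components_eq using comp_in_components[of x] x C by auto
    qed
    show "cycle_components X Y g \<subseteq> {C \<in> orbit h ` X. C \<inter> (X - Y) = {}}"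
    proof
      fix C assume "C \<in> cycle_components X Y g"
      then have C: "C \<in> graph_components X Y g" "C \<inter> (X - Y) = {}"
        unfolding cycle_components_eq by auto
      note cb = cycle_component_bij[OF C]
      obtain x where x: "x \<in> C" using C(1) graph_comp_self unfolding graph_components_altdef by blast
      have hC: "h z \<in> C" if "z \<in> C" for z
      proof -
        have "g z \<in> C" using cb(2) that by (auto simp: bij_betw_def)
        moreover have "z \<in> X" "g z \<in> X \<inter> Y" using calculation cb(1) that by blast+
        ultimately show ?thesis using h(2)[of z] J(1)[of "g z"] by simp
      qed
      have "z \<in> C" if "z \<in> orbit h x" for z using that by induction (use hC x in auto)
      then have "orbit h x \<inter> (X - Y) = {}" using C(2) by blast
      moreover have "x \<in> X" using x cb by blast
      ultimately show "C \<in> {C \<in> orbit h ` X. C \<inter> (X - Y) = {}}"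
        using key[of x] component_eq_comp[OF C(1) x] by auto
    qed
  qed
qed

text \<open>\<open>J\<close> joins the end of each path of \<open>g\<close> to its start, so that the components of \<open>g\<close> become
  the cycles of a permutation of \<open>Y\<close>.\<close>

lemma ex_path_closure:
  assumes card: "card X = card Y"
  shows "\<exists>J h. bij_betw J X Y \<and> (\<forall>y\<in>X \<inter> Y. J y = y) \<and> (\<forall>x\<in>X - Y. J x \<in> Y - X) \<and>
    h permutes Y \<and> (\<forall>x\<in>X. h (J x) = g x) \<and> cyc Y h = num_components X Y g"
proof -
  have "\<exists>y. y \<in> graph_comp X g x \<inter> (Y - X)" if "x \<in> X - Y" for x
    using path_component(3)[OF that] by blast
  \<comment> \<open>\<iota> sends each path start to an end of the same path, so \<open>J\<close>
    preserves components, and the uniqueness of starts makes it injective.\<close>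
  then obtain \<iota> where \<iota>: "\<And>x. x \<in> X - Y \<Longrightarrow> \<iota> x \<in> graph_comp X g x \<inter> (Y - X)" by metis
  define J where "J x = (if x \<in> Y then x else \<iota> x)" for x
  have J1: "J y = y" if "y \<in> Y" for y using that by (simp add: J_def)
  have J2: "J x \<in> Y - X" if "x \<in> X - Y" for x using \<iota>[OF that] that by (simp add: J_def)
  have Jc: "graph_comp X g (J x) = graph_comp X g x" if "x \<in> X" for x
    using \<iota>[of x] that graph_comp_eq[of "\<iota> x" X g x] by (cases "x \<in> Y") (auto simp: J_def)
  have Jinj: "inj_on J X"
  proof (rule inj_onI)
    fix x x' assume x: "x \<in> X" "x' \<in> X" and eq: "J x = J x'"
    have c: "graph_comp X g x = graph_comp X g x'" using Jc[OF x(1)] Jc[OF x(2)] eq by simp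
    show "x = x'"
    proof (cases "x \<in> Y")
      case True
      then have "J x' \<in> X" using J1 eq x by metis
      then have "x' \<in> Y" using J2[of x'] x by blast
      then show ?thesis using J1 True eq by metis
    next
      case False
      then have "J x \<notin> X" using J2[of x] x by blast
      then have "x' \<notin> Y" using eq J1[of x'] x by metis
      then have "graph_comp X g x \<inter> (X - Y) = {x}" "graph_comp X g x' \<inter> (X - Y) = {x'}"
        using path_component(2) x False by blast+
      then show ?thesis using c by (metis singleton_inject)
    qed
  qed
  have "J ` X \<subseteq> Y"
  proof
    fix y assume "y \<in> J ` X"
    then obtain x where "x \<in> X" "y = J x" by auto
    then show "y \<in> Y" using J1[of x] J2[of x] by (cases "x \<in> Y") auto
  qed
  then have "J ` X = Y" using finY card_image[OF Jinj] card by (metis card_subset_eq)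
  then have Jb: "bij_betw J X Y" using Jinj by (simp add: bij_betw_def)
  define h where "h y = (if y \<in> Y then g (inv_into X J y) else y)" for y
  have hJ: "h (J x) = g x" if "x \<in> X" for x
    using that \<open>J ` X = Y\<close> Jinj by (auto simp: h_def)
  have "bij_betw (g \<circ> inv_into X J) Y Y"
    using bij_betw_inv_into[OF Jb] bij by (rule bij_betw_trans)
  then have "bij_betw h Y Y" by (rule bij_betw_cong[THEN iffD1, rotated]) (simp add: h_def)
  then have hY: "h permutes Y" by (rule bij_imp_permutes) (simp add: h_def)
  have ph: "permutation h" using finY hY by (auto simp: permutation_permutes)
  \<comment> \<open>Each component loses only its start when it is cut down to \<open>Y\<close>, and
    what remains is one orbit of \<open>h\<close>.\<close>
  have orb: "orbit h y = graph_comp X g y \<inter> Y" if y: "y \<in> Y" for y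
  proof
    have "graph_comp X g (h z) = graph_comp X g z" if z: "z \<in> Y" for z
    proof -
      obtain x where "x \<in> X" "z = J x" using z \<open>J ` X = Y\<close> by blast
      then show ?thesis using hJ Jc graph_comp_image_eq[of x X g] by simp
    qed
    note hz = this
    have sub: "orbit h y \<subseteq> Y" using permutes_orbit_subset[OF hY y] .
    have "graph_comp X g z = graph_comp X g y" if "z \<in> orbit h y" for z
      using that
    proof induction
      case base
      show ?case using hz[OF y] .
    next
      case (step z)
      then show ?case using hz[of z] sub by blast
    qed
    then show "orbit h y \<subseteq> graph_comp X g y \<inter> Y" using sub graph_comp_self by blast
    \<comment> \<open>The orbit with the missing path start put back, recognised by its
      \<open>J\<close>-image; this makes the set closed under edges in both directions.\<close>
    let ?Z = "orbit h y \<union> {x \<in> X. J x \<in> orbit h y}"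
    have "graph_comp X g y \<subseteq> ?Z"
    proof (rule graph_comp_subset)
      show "y \<in> ?Z" using permutation_self_in_orbit[OF ph] by blast
    next
      fix z assume z: "z \<in> ?Z" "z \<in> X"
      then have "J z \<in> orbit h y" using J1[of z] sub by auto
      then show "g z \<in> ?Z" using orbit.step[of "J z" h y] hJ[OF z(2)] by simp
    next
      fix z assume z: "z \<in> X" "g z \<in> ?Z"
      have "g z \<in> Y" using z img by blast
      then have "g z \<in> orbit h y" using z J1[of "g z"] by auto
      then have "h (J z) \<in> orbit h y" using hJ[OF z(1)] by simp
      then have "J z \<in> orbit h y"
        using orbit_mem_sym[OF ph orbit.base[of h "J z"]] orbit_trans by metis
      then show "z \<in> ?Z" using z by blast
    qed
    moreover have "?Z \<inter> Y \<subseteq> orbit h y" using J1 by auto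
    ultimately show "graph_comp X g y \<inter> Y \<subseteq> orbit h y" by blast
  qed
  have "cyc Y h = card ((\<lambda>C. C \<inter> Y) ` graph_components X Y g)"
  proof -
    have "graph_components X Y g = graph_comp X g ` Y"
      unfolding graph_components_altdef
      using graph_comp_image_eq[of _ X g] img by (auto simp: image_iff)
    then have "(\<lambda>C. C \<inter> Y) ` graph_components X Y g = (\<lambda>y. graph_comp X g y \<inter> Y) ` Y"
      by (simp add: image_image)
    also have "\<dots> = orbit h ` Y" by (rule image_cong) (use orb in auto)
    finally show ?thesis by (simp add: cyc_def)
  qed
  also have "\<dots> = num_components X Y g"
    unfolding num_components_def
  proof (rule card_image, rule inj_onI)
    fix C C' assume C: "C \<in> graph_components X Y g" "C' \<in> graph_components X Y g"
      and eq: "C \<inter> Y = C' \<inter> Y"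
    obtain x where x: "x \<in> X \<union> Y" "C = graph_comp X g x"
      using C(1) unfolding graph_components_altdef by blast
    \<comment> \<open>A vertex outside \<open>Y\<close> lies in \<open>X\<close>, and its image is
      in \<open>Y\<close>. So the trace on \<open>Y\<close> is nonempty and determines the
      component.\<close>
    have "\<exists>z. z \<in> C \<inter> Y"
    proof (cases "x \<in> Y")
      case True
      then show ?thesis using x graph_comp_self[of x X g] by blast
    next
      case False
      then have "x \<in> X" using x by blast
      then show ?thesis
        using x graph_comp_image_eq[of x X g] graph_comp_self[of "g x" X g] img by blast
    qed
    then obtain z where "z \<in> C" "z \<in> C'" using eq by blast
    then show "C = C'" using component_eq_comp C by metis
  qed
  finally show ?thesis
    using Jb J1 J2 hY hJ by (intro exI[of _ J] exI[of _ h]) auto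
qed

end

text \<open>One map \<open>J\<close> serves both bijections. It satisfies
  \<open>h \<circ> J = D\<close> on \<open>B\<close>, so on \<open>A\<close> the permutation
  \<open>inv h \<circ> s\<close> is \<open>J\<close> after \<open>inv_into B D \<circ> s\<close>.
  Since \<open>J\<close> sends \<open>B - A\<close> into \<open>A - B\<close>, it also leads the
  path ends of the latter bijection to path starts.\<close>

lemma num_components_eq_avoiding:
  assumes A: "finite A" and B: "finite B" and card: "card A = card B" and D: "bij_betw D B A"
  shows "\<exists>h. h permutes A \<and> cyc A h = num_components B A D \<and>
    (\<forall>s. s permutes A \<longrightarrow>
      num_components A B (inv_into B D \<circ> s) = card (A - B) + avoiding A (A - B) (inv h \<circ> s))"
proof -
  interpret d: finite_bij B A D by unfold_locales (use A B D in auto)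
  obtain J h where J: "bij_betw J B A" "\<And>y. y \<in> B \<inter> A \<Longrightarrow> J y = y" "\<And>x. x \<in> B - A \<Longrightarrow> J x \<in> A - B"
    and h: "h permutes A" "\<And>x. x \<in> B \<Longrightarrow> h (J x) = D x" "cyc A h = num_components B A D"
    using d.ex_path_closure card by metis
  have "num_components A B (inv_into B D \<circ> s) = card (A - B) + avoiding A (A - B) (inv h \<circ> s)"
    if s: "s permutes A" for s
  proof -
    let ?f = "inv_into B D \<circ> s"
    have "bij_betw ?f A B"
      using bij_betw_trans[OF permutes_imp_bij[OF s] bij_betw_inv_into[OF D]] .
    then interpret f: finite_bij A B ?f by unfold_locales (use A B in auto)
    have p: "inv h \<circ> s permutes A" using permutes_compose[OF s permutes_inv[OF h(1)]] .
    have e: "(inv h \<circ> s) x = J (?f x)" if x: "x \<in> A" for x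
    proof -
      have sx: "s x \<in> A" using x permutes_in_image[OF s] by blast
      have fx: "?f x \<in> B" "D (?f x) = s x"
        using sx D by (auto simp: bij_betw_def inv_into_into f_inv_into_f)
      then show ?thesis using h(2)[of "?f x"] permutes_inv_eq[OF h(1)] by simp
    qed
    have "cycle_components A B ?f = {C \<in> orbit (inv h \<circ> s) ` A. C \<inter> (A - B) = {}}"
      by (rule f.cycle_components_eq_orbits[OF _ _ p e]) (use J in auto)
    then show ?thesis unfolding f.num_components_eq avoiding_def by simp
  qed
  then show ?thesis using h by blast
qed

section \<open>The inequality and its sharpness\<close>

lemma W_next_ge_half:
  assumes D: "bij_of_type n A B D lam mu"
    and lam: "2 \<le> length lam" "length lam < n - length mu"
  shows "W A B D (n - length mu) \<le> 2 * W A B D (n - length mu - 1)"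
proof -
  have A: "finite A" and B: "finite B" and cA: "card A = n" and cB: "card B = n"
    and bij: "bij_betw D B A" and ct: "component_type B A D = (lam, mu)"
    using D by (auto simp: bij_of_type_def)
  interpret d: finite_bij B A D by unfold_locales (use A B bij in auto)
  obtain h where h: "h permutes A" "cyc A h = num_components B A D"
    and nc: "\<And>s. s permutes A \<Longrightarrow>
      num_components A B (inv_into B D \<circ> s) = card (A - B) + avoiding A (A - B) (inv h \<circ> s)"
    using num_components_eq_avoiding[OF A B _ bij] cA cB by auto
  have p: "card (A - B) = length lam"
    using d.length_component_type(1)[OF ct] card_le_sym_Diff[OF A B] card_le_sym_Diff[OF B A] cA cB
    by simp
  have ch: "cyc A h = length lam + length mu"
    using h(2) d.num_components_eq d.length_component_type[OF ct] by simp
  \<comment> \<open>The strict bound on \<open>length lam\<close> says that \<open>h\<close> has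
    fewer than \<open>n\<close> cycles.\<close>
  have "h \<noteq> id" using ch lam cA cyc_id[of A] by auto
  have "2 \<le> card (A - B)" using p lam by simp
  note main = card_top_le_twice_next[OF A h(1) \<open>h \<noteq> id\<close> Diff_subset this]
  \<comment> \<open>Each bijection has \<open>length lam\<close> paths and \<open>h\<close> has
    \<open>length lam + length mu\<close> cycles, so the number of components turns into the number
    of avoiding orbits. The bound on \<open>length lam\<close> keeps the natural-number subtractions
    from being truncated.\<close>
  have "W A B D (n - length mu) =
    card {s. s permutes A \<and> cyclic_on s A \<and> avoiding A (A - B) (inv h \<circ> s) + cyc A h = card A}"
    unfolding W_def ch cA using nc p lam(2) by (intro arg_cong[where f = card] Collect_cong) auto
  moreover have "W A B D (n - length mu - 1) =
    card {s. s permutes A \<and> cyclic_on s A \<and> Suc (avoiding A (A - B) (inv h \<circ> s)) + cyc A h = card A}"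
    unfolding W_def ch cA using nc p lam(2) by (intro arg_cong[where f = card] Collect_cong) auto
  ultimately show ?thesis using main by simp
qed

section \<open>The extremal example on four elements\<close>

definition four_cycle :: "'a \<Rightarrow> 'a \<Rightarrow> 'a \<Rightarrow> 'a \<Rightarrow> 'a \<Rightarrow> 'a" where
  "four_cycle p q r t = id(p := q, q := r, r := t, t := p)"

lemma four_cycle:
  assumes "distinct [p, q, r, t]" "A = {p, q, r, t}"
  shows "four_cycle p q r t permutes A" and "cyclic_on (four_cycle p q r t) A"
proof -
  let ?s = "four_cycle p q r t"
  have s: "?s p = q" "?s q = r" "?s r = t" "?s t = p" "\<And>x. x \<notin> A \<Longrightarrow> ?s x = x"
    using assms by (auto simp: four_cycle_def)
  show perm: "?s permutes A"
    using s assms by (intro inj_imp_permutes) (auto simp: inj_on_def)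
  have "q \<in> orbit ?s p" using orbit.base[of ?s p] s by simp
  moreover from this have "r \<in> orbit ?s p" using orbit.step[of q ?s p] s by simp
  moreover from this have "t \<in> orbit ?s p" using orbit.step[of r ?s p] s by simp
  moreover from this have "p \<in> orbit ?s p" using orbit.step[of t ?s p] s by simp
  ultimately have "A \<subseteq> orbit ?s p" using assms by simp
  moreover have "orbit ?s p \<subseteq> A" using permutes_orbit_subset[OF perm] assms by simp
  ultimately have "A = orbit ?s p" by blast
  then show "cyclic_on ?s A" using assms by (auto simp: cyclic_on_def)
qed

lemma cyclic_on_four:
  assumes s: "s permutes A" "cyclic_on s A" and A: "card A = 4" "p \<in> A"
  obtains q r t where "distinct [p, q, r, t]" "A = {p, q, r, t}" "s = four_cycle p q r t"
proof -
  have fin: "finite A" using A by (metis card.infinite zero_neq_numeral)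
  have orb: "orbit s p = A" using s(2) A(2) by (rule orbit_cyclic_eq3)
  \<comment> \<open>A return to \<open>p\<close> after fewer than four steps would make its orbit
    smaller than \<open>A\<close>.\<close>
  have ne: "(s ^^ m) p \<noteq> p" if m: "0 < m" "m < 4" for m
  proof
    assume "(s ^^ m) p = p"
    then have "A = {(s ^^ i) p |i. i < m}" using orbit_altdef_bounded[of m s p] m(1) orb by simp
    also have "\<dots> = (\<lambda>i. (s ^^ i) p) ` {..<m}" by auto
    finally have "card A \<le> m" using card_image_le[of "{..<m}" "\<lambda>i. (s ^^ i) p"] by simp
    then show False using A m by simp
  qed
  define q r t where "q = s p" and "r = s q" and "t = s r"
  have inj: "s x = s y \<longleftrightarrow> x = y" for x y using permutes_inj[OF s(1)] by (auto dest: injD)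
  have n: "q \<noteq> p" "r \<noteq> p" "t \<noteq> p"
    using ne[of 1] ne[of 2] ne[of 3] by (auto simp: q_def r_def t_def eval_nat_numeral)
  have "r \<noteq> q" "t \<noteq> r" "t \<noteq> q"
    using n inj[of p q] inj[of q r] inj[of p r] by (auto simp: q_def r_def t_def inj)
  then have dist: "distinct [p, q, r, t]" using n by auto
  have mem: "q \<in> A" "r \<in> A" "t \<in> A"
    using A(2) permutes_in_image[OF s(1)] by (auto simp: q_def r_def t_def)
  have set: "{p, q, r, t} = A"
    using fin A mem dist by (intro card_subset_eq) auto
  have "s t \<in> {p, q, r, t}" unfolding set using mem permutes_in_image[OF s(1)] by blast
  moreover have "s t \<noteq> q" "s t \<noteq> r" "s t \<noteq> t"
    using dist inj[of t p] inj[of t q] inj[of t r] by (auto simp: q_def[symmetric] r_def[symmetric] t_def[symmetric])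
  ultimately have "s t = p" by blast
  then have "s x = four_cycle p q r t x" for x
    using dist set permutes_not_in[OF s(1), of x]
    by (auto simp: four_cycle_def q_def[symmetric] r_def[symmetric] t_def[symmetric])
  then show ?thesis using that[of q r t] dist set by (auto simp: fun_eq_iff)
qed

lemma ex_ratio_half:
  "\<exists>n (A :: nat set) B D lam mu.
     bij_of_type n A B D lam mu \<and> 2 \<le> length lam \<and> length lam < n - length mu \<and>
     W A B D (n - length mu) > 0 \<and>
     2 * W A B D (n - length mu - 1) = W A B D (n - length mu)"
proof -
  define A B :: "nat set" where "A = {0, 1, 2, 3}" and "B = {2, 3, 4, 5}"
  \<comment> \<open>Two paths with one edge each, from 4 to 0 and from 5 to 1, and a cycle that
    swaps 2 and 3.\<close>
  define D :: "nat \<Rightarrow> nat" where "D = id(4 := 0, 5 := 1, 2 := 3, 3 := 2)"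
  have A: "finite A" "card A = 4" and B: "finite B" "card B = 4" by (auto simp: A_def B_def)
  have AB: "A - B = {0, 1}" "B - A = {4, 5}" "B \<inter> A = {2, 3}" by (auto simp: A_def B_def)
  have bij: "bij_betw D B A" by (auto simp: bij_betw_def inj_on_def A_def B_def D_def)
  interpret d: finite_bij B A D by unfold_locales (use A B bij in auto)
  obtain lam mu where ct: "component_type B A D = (lam, mu)" by fastforce
  have lam: "length lam = 2" using d.length_component_type(1)[OF ct] AB by simp
  have cc: "cycle_components B A D = {{2, 3}}"
  proof
    show "cycle_components B A D \<subseteq> {{2, 3}}"
    proof
      fix C assume "C \<in> cycle_components B A D"
      then have C: "C \<in> graph_components B A D" "C \<inter> (B - A) = {}"
        unfolding d.cycle_components_eq by auto
      have sub: "C \<subseteq> {2, 3}" and DC: "D ` C = C"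
        using d.cycle_component_bij[OF C] AB by (auto simp: bij_betw_def)
      obtain x where "C = graph_comp B D x" using C(1) unfolding graph_components_altdef by auto
      then have "C \<noteq> {}" using graph_comp_self[of x B D] by blast
      moreover have D23: "D 2 = 3" "D 3 = 2" by (simp_all add: D_def)
      have "2 \<in> C \<longleftrightarrow> 3 \<in> C" using imageI[of 2 C D] imageI[of 3 C D] unfolding DC D23 by blast
      ultimately have "C = {2, 3}" using sub by blast
      then show "C \<in> {{2, 3}}" by simp
    qed
    have sub: "graph_comp B D 2 \<subseteq> {2, 3}"
      by (rule graph_comp_subset) (auto simp: B_def D_def split: if_splits)
    have "3 \<in> graph_comp B D 2"
      using graph_comp_image_eq[of 2 B D] graph_comp_self[of 3 B D] by (simp add: B_def D_def)
    then have "graph_comp B D 2 = {2, 3}" using sub graph_comp_self[of 2 B D] by blast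
    then have "{2, 3} \<in> graph_components B A D"
      using d.comp_in_components[of 2] by (simp add: A_def)
    then show "{{2, 3}} \<subseteq> cycle_components B A D"
      unfolding d.cycle_components_eq AB by simp
  qed
  then have mu: "length mu = 1" using d.length_component_type(2)[OF ct] by simp
  have bt: "bij_of_type 4 A B D lam mu"
    unfolding bij_of_type_def using A B bij ct by simp
  obtain h where h: "h permutes A" "cyc A h = num_components B A D"
    and nc: "\<And>s. s permutes A \<Longrightarrow>
      num_components A B (inv_into B D \<circ> s) = card (A - B) + avoiding A (A - B) (inv h \<circ> s)"
    using num_components_eq_avoiding[OF A(1) B(1) _ bij] A B by auto
  have ch: "cyc A h = 3" using h(2) d.num_components_eq cc AB by simp
  let ?Z = "{s. s permutes A \<and> cyclic_on s A}"
  let ?X = "{s. s permutes A \<and> cyclic_on s A \<and> num_components A B (inv_into B D \<circ> s) = 3}"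
  let ?Y = "{s. s permutes A \<and> cyclic_on s A \<and> num_components A B (inv_into B D \<circ> s) = 2}"
  have finZ: "finite ?Z" using finite_permutations[OF A(1)] by (auto intro: rev_finite_subset)
  \<comment> \<open>Since \<open>D\<close> swaps 2 and 3, the last condition makes
    \<open>inv_into B D \<circ> s\<close> fix 2 or 3. This loop is a component besides the two
    paths, and \<open>avoiding_le\<close> allows no more than three components.\<close>
  have top: "s \<in> ?X" if s: "s permutes A" "cyclic_on s A" "s 2 = 3 \<or> s 3 = 2" for s
  proof -
    have "avoiding A (A - B) (inv h \<circ> s) \<le> 1"
      using avoiding_le[OF A(1) h(1) s(1,2) Diff_subset, of B] AB ch A(2) by simp
    then have le: "num_components A B (inv_into B D \<circ> s) \<le> 3" using nc[OF s(1)] AB by simp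
    let ?f = "inv_into B D \<circ> s"
    have "bij_betw ?f A B"
      using bij_betw_trans[OF permutes_imp_bij[OF s(1)] bij_betw_inv_into[OF bij]] .
    then interpret f: finite_bij A B ?f by unfold_locales (use A B in auto)
    have inv: "inv_into B D 3 = 2" "inv_into B D 2 = 3"
      using inv_into_f_f[OF d.inj, of 2] inv_into_f_f[OF d.inj, of 3] by (auto simp: B_def D_def)
    have "\<exists>x\<in>{2, 3}. ?f x = x" using s(3) inv by auto
    then obtain x where x: "x \<in> {2, 3}" "?f x = x" by blast
    have xA: "x \<in> A" "x \<notin> A - B" using x by (auto simp: A_def B_def)
    have "graph_comp A ?f x \<subseteq> {x}"
    proof (rule graph_comp_subset)
      fix z assume "z \<in> A" "?f z \<in> {x}"
      then show "z \<in> {x}" using f.inj x(2) xA by (metis inj_onD singletonD singletonI)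
    qed (use x in auto)
    then have "graph_comp A ?f x \<inter> (A - B) = {}" using xA by blast
    then have "graph_comp A ?f x \<in> cycle_components A B ?f"
      unfolding f.cycle_components_eq using f.comp_in_components[of x] xA by blast
    moreover have "finite (cycle_components A B ?f)"
      unfolding f.cycle_components_eq using f.finite_components by simp
    ultimately have "card (cycle_components A B ?f) > 0" by (auto simp: card_gt_0_iff)
    then have "num_components A B ?f \<ge> 3" using f.num_components_eq AB by simp
    then show ?thesis using le s by simp
  qed
  have X4: "4 \<le> card ?X"
  proof -
    let ?L = "[four_cycle 2 3 0 1, four_cycle 2 3 1 0, four_cycle 3 2 0 1, four_cycle 3 2 1 (0::nat)]"
    have sub: "set ?L \<subseteq> ?X"
    proof
      fix s assume "s \<in> set ?L"
      then consider "s = four_cycle 2 3 0 1" | "s = four_cycle 2 3 1 0"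
        | "s = four_cycle 3 2 0 1" | "s = four_cycle 3 2 1 0" by auto
      then have "s permutes A \<and> cyclic_on s A \<and> (s 2 = 3 \<or> s 3 = 2)"
      proof cases
        case 1
        have "A = {2, 3, 0, 1}" by (auto simp: A_def)
        then show ?thesis using 1 four_cycle[of 2 3 0 1 A] by (simp add: four_cycle_def)
      next
        case 2
        have "A = {2, 3, 1, 0}" by (auto simp: A_def)
        then show ?thesis using 2 four_cycle[of 2 3 1 0 A] by (simp add: four_cycle_def)
      next
        case 3
        have "A = {3, 2, 0, 1}" by (auto simp: A_def)
        then show ?thesis using 3 four_cycle[of 3 2 0 1 A] by (simp add: four_cycle_def)
      next
        case 4
        have "A = {3, 2, 1, 0}" by (auto simp: A_def)
        then show ?thesis using 4 four_cycle[of 3 2 1 0 A] by (simp add: four_cycle_def)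
      qed
      then show "s \<in> ?X" using top by blast
    qed
    \<comment> \<open>The values at 2 and 3 already tell the four cycles apart.\<close>
    have "distinct (map (\<lambda>s. (s 2, s 3)) ?L)" by (simp add: four_cycle_def)
    then have "distinct ?L" unfolding distinct_map by (rule conjunct1)
    then have "card (set ?L) = length ?L" by (rule distinct_card)
    moreover have "finite ?X" using finZ by (rule rev_finite_subset) auto
    then have "card (set ?L) \<le> card ?X" using sub by (rule card_mono)
    ultimately show ?thesis by simp
  qed
  have Z6: "card ?Z \<le> 6"
  proof -
    let ?L = "[four_cycle 0 1 2 3, four_cycle 0 1 3 2, four_cycle 0 2 1 3, four_cycle 0 2 3 1,
      four_cycle 0 3 1 2, four_cycle 0 3 2 (1::nat)]"
    have "?Z \<subseteq> set ?L"
    proof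
      fix s assume "s \<in> ?Z"
      then have s: "s permutes A" "cyclic_on s A" by auto
      obtain q r t where q: "distinct [0, q, r, t]" "A = {0, q, r, t}" "s = four_cycle 0 q r t"
        using cyclic_on_four[OF s A(2), of 0] by (auto simp: A_def)
      have "q \<in> A" "r \<in> A" "t \<in> A" using q by auto
      then have "q \<in> {1, 2, 3}" "r \<in> {1, 2, 3}" "t \<in> {1, 2, 3}" using q(1) by (auto simp: A_def)
      then show "s \<in> set ?L" using q(1) unfolding q(3) by auto
    qed
    then have "card ?Z \<le> card (set ?L)" by (intro card_mono) auto
    also have "\<dots> \<le> length ?L" by (rule card_length)
    finally show ?thesis by simp
  qed
  have fin: "finite ?X" "finite ?Y" using finZ by (auto intro: rev_finite_subset)
  have "?X \<inter> ?Y = {}" "?X \<union> ?Y \<subseteq> ?Z" by auto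
  then have XY: "card ?X + card ?Y \<le> 6"
    using card_mono[OF finZ, of "?X \<union> ?Y"] card_Un_disjoint[OF fin] Z6 by linarith
  have W: "W A B D (4 - length mu) = card ?X" "W A B D (4 - length mu - 1) = card ?Y"
    unfolding W_def mu by simp_all
  have "card ?X \<le> 2 * card ?Y"
    using W_next_ge_half[OF bt] lam mu W by simp
  then have "W A B D (4 - length mu) > 0" "2 * W A B D (4 - length mu - 1) = W A B D (4 - length mu)"
    using X4 XY unfolding W by linarith+
  moreover have "2 \<le> length lam" "length lam < 4 - length mu" using lam mu by simp_all
  ultimately show ?thesis using bt by blast
qed

text \<open>Sharpness is stated twice: every larger constant fails, and equality is attained.
  Positivity of the top count keeps the equality from being \<open>0 = 0\<close> and makes each
  larger \<open>c\<close> fail for the same example.\<close>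

theorem theorem2:
  shows
    "(\<forall>n (A :: 'a set) B D lam mu.
        bij_of_type n A B D lam mu \<longrightarrow> 2 \<le> length lam \<longrightarrow> length lam < n - length mu \<longrightarrow>
        real (W A B D (n - length mu - 1)) \<ge> 1/2 * real (W A B D (n - length mu)))
     \<and>
     (\<forall>c :: real. c > 1/2 \<longrightarrow>
        (\<exists>n (A :: nat set) B D lam mu.
           bij_of_type n A B D lam mu \<and> 2 \<le> length lam \<and> length lam < n - length mu \<and>
           \<not> real (W A B D (n - length mu - 1)) \<ge> c * real (W A B D (n - length mu))))
     \<and>
     (\<exists>n (A :: nat set) B D lam mu.
        bij_of_type n A B D lam mu \<and> 2 \<le> length lam \<and> length lam < n - length mu \<and>
        W A B D (n - length mu) > 0 \<and>
        real (W A B D (n - length mu - 1)) = 1/2 * real (W A B D (n - length mu)))"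
proof (intro conjI allI impI)
  fix n lam mu and A B :: "'a set" and D
  assume "bij_of_type n A B D lam mu" "2 \<le> length lam" "length lam < n - length mu"
  from W_next_ge_half[OF this]
  have "real (W A B D (n - length mu)) \<le> real (2 * W A B D (n - length mu - 1))"
    by (simp only: of_nat_le_iff)
  then show "real (W A B D (n - length mu - 1)) \<ge> 1/2 * real (W A B D (n - length mu))" by simp
next
  obtain n lam mu and A B :: "nat set" and D where ex: "bij_of_type n A B D lam mu"
    "2 \<le> length lam" "length lam < n - length mu" "W A B D (n - length mu) > 0"
    "2 * W A B D (n - length mu - 1) = W A B D (n - length mu)"
    using ex_ratio_half by metis
  have "real (2 * W A B D (n - length mu - 1)) = real (W A B D (n - length mu))"
    using ex(5) by (simp only:)
  then have half: "real (W A B D (n - length mu - 1)) = 1/2 * real (W A B D (n - length mu))"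
    by simp
  then show "\<exists>n (A :: nat set) B D lam mu.
        bij_of_type n A B D lam mu \<and> 2 \<le> length lam \<and> length lam < n - length mu \<and>
        W A B D (n - length mu) > 0 \<and>
        real (W A B D (n - length mu - 1)) = 1/2 * real (W A B D (n - length mu))"
    using ex(1-4) by metis
  fix c :: real assume "c > 1/2"
  then have "\<not> real (W A B D (n - length mu - 1)) \<ge> c * real (W A B D (n - length mu))"
    unfolding half using ex(4) by simp
  then show "\<exists>n (A :: nat set) B D lam mu.
           bij_of_type n A B D lam mu \<and> 2 \<le> length lam \<and> length lam < n - length mu \<and>
           \<not> real (W A B D (n - length mu - 1)) \<ge> c * real (W A B D (n - length mu))"
    using ex(1-3) by metis
qed

end
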